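(* Fix $\alpha\ge -\frac12$ and $x\ge 0$. Let $R$ be a hyperbolic Bessel process of index $\alpha$ with $R_0=x$. Then for every $t>0$ and $\lambda>0$, $$\mathbb{E}\bigl[\exp(-\lambda\cosh R_t)\bigr]=\mathbb{E}\Bigl[\exp\Bigl(-\lambda\cosh(x)\,V_t-\frac{\lambda^2}{2}\int_0^tV_u^2\,du\Bigr)\Bigr],$$ where $V_t=e^{(\alpha+\frac12)t+B_t}$ and $B$ is a standard Brownian motion.
   Context: Hyperbolic Bessel process. On a filtered probability space satisfying the usual conditions and carrying a standard Brownian motion $B$, a hyperbolic Bessel process of index $\alpha$ starting from $x\ge 0$ is defined as follows. For $\alpha\in(-\frac12,\infty)$ it is the nonnegative diffusion $R$ with $R_t=x+B_t+(\alpha+\frac12)\int_0^t\coth R_u\,du$; for $\alpha\in(-\frac12,0)$ the point $0$ is instantaneously reflecting and the equation is understood as $dR_t=dB_t+(\alpha+\frac12)\mathbf{1}_{\{R_t\ne0\}}\coth R_t\,dt$, $R_0=x$. For $\alpha=-\frac12$ it is $R_t=|x+B_t|$. *)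

theory Defs
  imports "HOL-Probability.Probability"
begin

text \<open>
  Time runs through the nonnegative reals. The library locale \<open>filtration\<close> indexes by a whole
  type; the values of \<open>F\<close> at negative times play no role and may be taken to be \<open>F 0\<close>.
\<close>

locale filtered_prob_space = prob_space M + filtration "space M" F
  for M :: "'a measure" and F :: "real \<Rightarrow> 'a measure" +
  assumes subalgebra_F: "subalgebra M (F t)"

locale usual_conditions = filtered_prob_space +
  assumes right_continuous: "t \<ge> 0 \<Longrightarrow> sets (F t) = (\<Inter>s\<in>{t<..}. sets (F s))"
    and contains_negligible: "A \<subseteq> Z \<Longrightarrow> Z \<in> null_sets M \<Longrightarrow> A \<in> sets (F 0)"

text \<open>
  A process is a Brownian motion without reference to a filtration iff it is one for the filtration
  that it generates, so that case is covered too.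
\<close>

locale brownian_motion = filtered_prob_space +
  fixes B :: "real \<Rightarrow> 'a \<Rightarrow> real"
  assumes starts_at_zero: "AE \<omega> in M. B 0 \<omega> = 0"
    and adapted: "t \<ge> 0 \<Longrightarrow> B t \<in> borel_measurable (F t)"
    and continuous_paths: "\<omega> \<in> space M \<Longrightarrow> continuous_on {0..} (\<lambda>t. B t \<omega>)"
    and indep_increments: "0 \<le> s \<Longrightarrow> s < t \<Longrightarrow>
      indep_set (sets (F s)) (sets (vimage_algebra (space M) (\<lambda>\<omega>. B t \<omega> - B s \<omega>) borel))"
    and normal_increments: "0 \<le> s \<Longrightarrow> s < t \<Longrightarrow>
      distributed M lborel (\<lambda>\<omega>. B t \<omega> - B s \<omega>) (normal_density 0 (sqrt (t - s)))"

definition coth :: "real \<Rightarrow> real" where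
  "coth r = cosh r / sinh r"

text \<open>
  Nonnegative solution of \<open>R t = x + B t + (\<alpha> + 1/2) * \<integral>\<^sub>0\<^sup>t coth (R u) du\<close>. The time spent at \<open>0\<close>
  is required to be Lebesgue-null: for \<open>\<alpha> < 0\<close> this is instantaneous reflection, and for \<open>\<alpha> \<ge> 0\<close>
  it is part of the finiteness of the integral, where \<open>coth 0 = \<infinity>\<close> (in HOL \<open>coth 0 = 0\<close>).
  Given this, the integrals with and without the indicator of \<open>R u \<noteq> 0\<close> agree, and one
  equation serves for all \<open>\<alpha> > -1/2\<close>.
\<close>

definition hyperbolic_bessel_sde ::
  "'a measure \<Rightarrow> (real \<Rightarrow> 'a \<Rightarrow> real) \<Rightarrow> real \<Rightarrow> real \<Rightarrow> (real \<Rightarrow> 'a \<Rightarrow> real) \<Rightarrow> bool" where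
  "hyperbolic_bessel_sde M B \<alpha> x R \<longleftrightarrow>
    (AE \<omega> in M.
      (\<forall>t\<ge>0. R t \<omega> \<ge> 0) \<and>
      continuous_on {0..} (\<lambda>t. R t \<omega>) \<and>
      {t\<in>{0..}. R t \<omega> = 0} \<in> null_sets lborel \<and>
      (\<forall>t\<ge>0.
        set_integrable lborel {0..t} (\<lambda>u. if R u \<omega> \<noteq> 0 then coth (R u \<omega>) else 0) \<and>
        R t \<omega> = x + B t \<omega> + (\<alpha> + 1/2) * (LBINT u:{0..t}. if R u \<omega> \<noteq> 0 then coth (R u \<omega>) else 0)))"

text \<open>Meaningful for \<open>\<alpha> \<ge> -1/2\<close> and \<open>x \<ge> 0\<close> only.\<close>

definition hyperbolic_bessel_process ::
  "'a measure \<Rightarrow> (real \<Rightarrow> 'a measure) \<Rightarrow> (real \<Rightarrow> 'a \<Rightarrow> real) \<Rightarrow> real \<Rightarrow> real \<Rightarrow>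
    (real \<Rightarrow> 'a \<Rightarrow> real) \<Rightarrow> bool" where
  "hyperbolic_bessel_process M F B \<alpha> x R \<longleftrightarrow>
    usual_conditions M F \<and> brownian_motion M F B \<and>
    (\<forall>t\<ge>0. R t \<in> borel_measurable (F t)) \<and>
    (if \<alpha> = -1/2 then (AE \<omega> in M. \<forall>t\<ge>0. R t \<omega> = \<bar>x + B t \<omega>\<bar>)
     else hyperbolic_bessel_sde M B \<alpha> x R)"

end

theory Submission
  imports Defs
begin

text \<open>
  Put \<open>\<mu> = \<alpha> + 1/2\<close> and \<open>D\<^sub>u = \<lambda>\<^sup>2/2 \<integral>\<^sub>0\<^sup>u V\<^sub>r\<^sup>2 dr\<close>. The identity is a duality between \<open>cosh R\<close> and \<open>V\<close>:
  on the kernel \<open>h(r, v) = exp (- \<lambda> v cosh r)\<close> the generator of \<open>R\<close>, acting in \<open>r\<close>, agrees with the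
  generator of \<open>V\<close> killed at rate \<open>\<lambda>\<^sup>2 v\<^sup>2 / 2\<close>, acting in \<open>v\<close>. With \<open>p = \<lambda> v\<close> both give
  \<open>(p\<^sup>2 sinh\<^sup>2 r / 2 - (\<mu> + 1/2) p cosh r) exp (- p cosh r)\<close>: on the side of \<open>R\<close> the singular drift
  \<open>coth r\<close> meets a factor \<open>sinh r\<close> and becomes harmless, and on the side of \<open>V\<close> the killing supplies
  the term \<open>- p\<^sup>2 / 2\<close> that turns \<open>cosh\<^sup>2 r\<close> into \<open>sinh\<^sup>2 r\<close>. This common function is
  \<open>cosh_generator\<close>; it is bounded, uniformly in \<open>p\<close>.

  Take \<open>R\<close> and \<open>V\<close> independent and let \<open>\<phi> s \<tau>\<close> be the expectation of
  \<open>exp (- \<lambda> V\<^sub>\<tau> cosh R\<^sub>s - D\<^sub>\<tau>)\<close>. The evolution equations \<open>expectation_exp_cosh\<close> (for \<open>R\<close>) and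
  \<open>expectation_exp_functional\<close> (for \<open>V\<close>) say that \<open>\<phi>\<close> has the same continuous partial derivative in
  \<open>s\<close> and in \<open>\<tau>\<close>. So \<open>\<phi> s (t - s)\<close> does not depend on \<open>s\<close> (\<open>equal_partials_antidiagonal\<close>), and its
  values at \<open>s = t\<close> and \<open>s = 0\<close> are the two sides of the theorem.

  Both evolution equations come from one estimate, \<open>dynkin_estimate\<close>, which replaces Ito's formula.
  Each process is a Brownian motion plus a part of finite variation, and the test function carries a
  weight \<open>exp (- D)\<close> of finite variation. On a uniform time grid every increment is split into a move
  in the direction of \<open>B\<close>, with the part of finite variation frozen, and a move of the part of finite
  variation. The first is handled in expectation by Taylor's formula and the independence of the
  increments (\<open>one_step_estimate\<close>), the second path by path, as a Riemann-Stieltjes sum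
  (\<open>fv_sums_tendsto\<close>); hence no stochastic integral occurs.

  For \<open>\<alpha> = -1/2\<close> one has \<open>cosh R = cosh (x + B)\<close>, and \<open>x + B\<close> takes the place of \<open>R\<close>. For
  \<open>\<alpha> > -1/2\<close> the part of finite variation is \<open>C\<^sub>s = R\<^sub>s - B\<^sub>s\<close>, whose drift is unbounded. The weight
  \<open>exp (- (C\<^sub>s - x) / n)\<close> makes its total contribution bounded by \<open>n\<close> without any information on the
  moments of \<open>C\<close>, and it disappears as \<open>n\<close> tends to infinity.
\<close>

section \<open>Riemann-Stieltjes sums on a uniform grid\<close>

lemma grid_bounds:
  fixes t :: real
  assumes "t \<ge> 0" "k < n"
  shows "0 \<le> t * real k / real n" "t * real k / real n \<le> t * real (Suc k) / real n"
    "t * real (Suc k) / real n \<le> t"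
proof -
  show "0 \<le> t * real k / real n" using assms by simp
  show "t * real k / real n \<le> t * real (Suc k) / real n"
    using assms by (intro divide_right_mono mult_left_mono) auto
  have "t * real (Suc k) \<le> t * real n" using assms by (intro mult_left_mono) auto
  then show "t * real (Suc k) / real n \<le> t" using assms by (simp add: divide_simps)
qed

lemma grid_step: "t * real (Suc k) / real n - t * real k / real n = t / real n"
  by (simp add: diff_divide_distrib[symmetric] distrib_left)

lemma integral_eq_sum_over_grid:
  fixes h :: "real \<Rightarrow> real"
  assumes "t \<ge> 0" "n > 0" "h integrable_on {0..t}"
  shows "(\<Sum>k<n. integral {t * real k / real n..t * real (Suc k) / real n} h) = integral {0..t} h"
proof -
  have "(\<Sum>k<j. integral {t * real k / real n..t * real (Suc k) / real n} h)
      = integral {0..t * real j / real n} h" if "j \<le> n" for j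
    using that
  proof (induction j)
    case (Suc j)
    have b: "0 \<le> t * real j / real n" "t * real j / real n \<le> t * real (Suc j) / real n"
      "t * real (Suc j) / real n \<le> t"
      using grid_bounds[of t j n] assms Suc by auto
    have "h integrable_on {0..t * real (Suc j) / real n}"
      by (rule integrable_on_subinterval[OF assms(3)]) (use b in auto)
    from Henstock_Kurzweil_Integration.integral_combine[OF b(1,2) this] Suc show ?case by simp
  qed simp
  from this[of n] assms show ?thesis by simp
qed

lemma uniformly_continuous_grid:
  fixes b :: "real \<Rightarrow> real"
  assumes "t > 0" "continuous_on {0..t} b" "e > 0"
  shows "\<forall>\<^sub>F n in sequentially. \<forall>k<n. \<forall>u\<in>{t * real k / real n..t * real (Suc k) / real n}.
    \<forall>v\<in>{t * real k / real n..t * real (Suc k) / real n}. \<bar>b u - b v\<bar> < e"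
proof -
  have "uniformly_continuous_on {0..t} b"
    by (rule compact_uniformly_continuous[OF assms(2)]) simp
  then obtain d where d: "d > 0"
    "\<And>u v. u \<in> {0..t} \<Longrightarrow> v \<in> {0..t} \<Longrightarrow> dist v u < d \<Longrightarrow> dist (b v) (b u) < e"
    unfolding uniformly_continuous_on_def using assms(3) by metis
  have "(\<lambda>n. t / real n) \<longlonglongrightarrow> 0" by (rule lim_const_over_n)
  then have "\<forall>\<^sub>F n in sequentially. t / real n < d"
    using d(1) by (rule order_tendstoD)
  then show ?thesis
  proof eventually_elim
    case (elim n)
    show ?case
    proof (intro allI impI ballI)
      fix k u v
      assume k: "k < n" and u: "u \<in> {t * real k / real n..t * real (Suc k) / real n}"
        and v: "v \<in> {t * real k / real n..t * real (Suc k) / real n}"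
      have b: "0 \<le> t * real k / real n" "t * real (Suc k) / real n \<le> t"
        using grid_bounds[of t k n] assms k by auto
      have "t * real (Suc k) / real n - t * real k / real n = t / real n"
        by (rule grid_step)
      then have "dist u v < d" using u v elim by (auto simp: dist_real_def)
      then have "dist (b u) (b v) < e" using d(2)[of v u] u v b by auto
      then show "\<bar>b u - b v\<bar> < e" by (simp add: dist_real_def)
    qed
  qed
qed

lemma continuous_times_integrable:
  fixes g c :: "real \<Rightarrow> real"
  assumes "continuous_on {a..b} g" "c integrable_on {a..b}" "\<And>u. u \<in> {a..b} \<Longrightarrow> 0 \<le> c u"
  shows "(\<lambda>u. g u * c u) integrable_on {a..b}"
proof -
  have "c absolutely_integrable_on {a..b}"
    using assms by (intro nonnegative_absolutely_integrable_1) auto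
  moreover have "g \<in> borel_measurable (lebesgue_on {a..b})"
    by (intro continuous_imp_measurable_on_sets_lebesgue assms) auto
  moreover have "bounded (g ` {a..b})"
    by (intro compact_imp_bounded compact_continuous_image assms) auto
  ultimately have "(\<lambda>u. g u * c u) absolutely_integrable_on {a..b}"
    by (intro absolutely_integrable_bounded_measurable_product_real) auto
  then show ?thesis by (rule set_lebesgue_integral_eq_integral(1))
qed

text \<open>
  The tags \<open>\<gamma> n k\<close> need not be values of \<open>g\<close>: it suffices that they are uniformly close to \<open>g\<close> on
  their cells. This admits the intermediate points of the mean value theorem, and values in which
  several paths are taken at different ends of the cell. The error is then at most \<open>e\<close> times the
  total mass of \<open>c\<close>.
\<close>

lemma tagged_sums_tendsto:
  fixes g c :: "real \<Rightarrow> real" and \<gamma> :: "nat \<Rightarrow> nat \<Rightarrow> real"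
  assumes t: "t > 0" and g: "continuous_on {0..t} g"
    and c: "c integrable_on {0..t}" and c0: "\<And>u. u \<in> {0..t} \<Longrightarrow> 0 \<le> c u"
    and close: "\<And>e. e > 0 \<Longrightarrow> \<forall>\<^sub>F n in sequentially. \<forall>k<n.
      \<forall>u\<in>{t * real k / real n..t * real (Suc k) / real n}. \<bar>\<gamma> n k - g u\<bar> \<le> e"
  shows "(\<lambda>n. \<Sum>k<n. \<gamma> n k * integral {t * real k / real n..t * real (Suc k) / real n} c)
    \<longlonglongrightarrow> integral {0..t} (\<lambda>u. g u * c u)"
proof (rule tendstoI)
  fix e :: real assume e: "e > 0"
  define K where "K = integral {0..t} c"
  have K: "K \<ge> 0" unfolding K_def by (rule integral_nonneg[OF c c0])
  define e' where "e' = e / (K + 1)"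
  have e': "e' > 0" "e' * K < e" using e K by (auto simp: e'_def field_simps)
  have gc: "(\<lambda>u. g u * c u) integrable_on {0..t}"
    by (rule continuous_times_integrable[OF g c c0])
  show "\<forall>\<^sub>F n in sequentially. dist
      (\<Sum>k<n. \<gamma> n k * integral {t * real k / real n..t * real (Suc k) / real n} c)
      (integral {0..t} (\<lambda>u. g u * c u)) < e"
    using close[OF e'(1)] eventually_gt_at_top[of 0]
  proof eventually_elim
    case (elim n)
    let ?I = "\<lambda>k. {t * real k / real n..t * real (Suc k) / real n}"
    have sub: "?I k \<subseteq> {0..t}" if "k < n" for k
      using grid_bounds[of t k n] t that by auto
    have one: "\<bar>\<gamma> n k * integral (?I k) c - integral (?I k) (\<lambda>u. g u * c u)\<bar>
        \<le> e' * integral (?I k) c" if k: "k < n" for k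
    proof -
      have ci: "c integrable_on ?I k"
        by (rule integrable_on_subinterval[OF c sub[OF k]])
      have gi: "(\<lambda>u. g u * c u) integrable_on ?I k"
        by (rule integrable_on_subinterval[OF gc sub[OF k]])
      have "\<gamma> n k * integral (?I k) c - integral (?I k) (\<lambda>u. g u * c u)
          = integral (?I k) (\<lambda>u. \<gamma> n k * c u - g u * c u)"
        by (subst Henstock_Kurzweil_Integration.integral_diff)
          (use ci gi in \<open>auto intro: integrable_on_mult_right\<close>)
      also have "norm \<dots> \<le> integral (?I k) (\<lambda>u. e' * c u)"
      proof (rule integral_norm_bound_integral)
        fix u assume u: "u \<in> ?I k"
        have "\<bar>\<gamma> n k - g u\<bar> * c u \<le> e' * c u"
          using elim k u c0[of u] sub[OF k] by (intro mult_right_mono) auto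
        then show "norm (\<gamma> n k * c u - g u * c u) \<le> e' * c u"
          using c0[of u] sub[OF k] u by (auto simp: abs_mult left_diff_distrib[symmetric])
      qed (use ci gi in \<open>auto intro!: integrable_diff integrable_on_mult_right\<close>)
      finally show ?thesis by simp
    qed
    have "(\<Sum>k<n. \<gamma> n k * integral (?I k) c) - integral {0..t} (\<lambda>u. g u * c u)
        = (\<Sum>k<n. \<gamma> n k * integral (?I k) c - integral (?I k) (\<lambda>u. g u * c u))"
      using integral_eq_sum_over_grid[of t n, OF _ _ gc] t elim by (simp add: sum_subtractf)
    then have "\<bar>(\<Sum>k<n. \<gamma> n k * integral (?I k) c) - integral {0..t} (\<lambda>u. g u * c u)\<bar>
        = \<bar>\<Sum>k<n. \<gamma> n k * integral (?I k) c - integral (?I k) (\<lambda>u. g u * c u)\<bar>"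
      by (rule arg_cong)
    also have "\<dots> \<le> (\<Sum>k<n. e' * integral (?I k) c)"
      by (rule order_trans[OF sum_abs sum_mono]) (use one in auto)
    also have "\<dots> = e' * (\<Sum>k<n. integral (?I k) c)"
      by (simp only: sum_distrib_left)
    also have "(\<Sum>k<n. integral (?I k) c) = K"
      unfolding K_def by (rule integral_eq_sum_over_grid) (use t elim(2) c in simp_all)
    finally show ?case using e' by (simp add: dist_real_def)
  qed
qed

lemma riemann_sums_tendsto:
  fixes g :: "real \<Rightarrow> real"
  assumes "t > 0" "continuous_on {0..t} g"
  shows "(\<lambda>n. \<Sum>k<n. g (t * real k / real n) * (t / real n)) \<longlonglongrightarrow> integral {0..t} g"
proof -
  have "(\<lambda>n. \<Sum>k<n. g (t * real k / real n) *
      integral {t * real k / real n..t * real (Suc k) / real n} (\<lambda>_. 1))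
    \<longlonglongrightarrow> integral {0..t} (\<lambda>u. g u * 1)"
  proof (rule tagged_sums_tendsto[OF assms])
    fix e :: real assume "e > 0"
    from uniformly_continuous_grid[OF assms this]
    show "\<forall>\<^sub>F n in sequentially. \<forall>k<n.
      \<forall>u\<in>{t * real k / real n..t * real (Suc k) / real n}. \<bar>g (t * real k / real n) - g u\<bar> \<le> e"
    proof eventually_elim
      case (elim n)
      then show ?case
        using grid_bounds(2)[of t _ n] assms(1) by (fastforce intro: less_imp_le)
    qed
  qed (simp_all add: integrable_const_ivl)
  moreover have "integral {t * real k / real n..t * real (Suc k) / real n} (\<lambda>_. 1) = t / real n" 
    if "k < n" for k n
  proof -
    have "integral {t * real k / real n..t * real (Suc k) / real n} (\<lambda>_. 1 :: real)
        = t * real (Suc k) / real n - t * real k / real n"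
      using grid_bounds(2)[of t k n] assms(1) that
      by (metis content_real integral_const_real mult.right_neutral real_scaleR_def order_less_imp_le)
    then show ?thesis by (simp only: grid_step)
  qed
  ultimately show ?thesis by simp
qed

section \<open>Bounded continuous processes\<close>

lemma expectation_continuous_on:
  fixes Y :: "'b :: metric_space \<Rightarrow> 'a \<Rightarrow> real"
  assumes M: "prob_space M"
    and Y: "\<And>u. u \<in> S \<Longrightarrow> Y u \<in> borel_measurable M"
    and bound: "\<And>u \<omega>. u \<in> S \<Longrightarrow> \<omega> \<in> space M \<Longrightarrow> \<bar>Y u \<omega>\<bar> \<le> K"
    and cont: "AE \<omega> in M. continuous_on S (\<lambda>u. Y u \<omega>)"
  shows "continuous_on S (\<lambda>u. LINT \<omega>|M. Y u \<omega>)"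
proof -
  interpret prob_space M by fact
  show ?thesis
    unfolding continuous_on_sequentially
  proof (intro allI impI ballI, elim conjE)
    fix X a assume a: "a \<in> S" "\<forall>n. X n \<in> S" "X \<longlonglongrightarrow> a"
    have "(\<lambda>n. LINT \<omega>|M. Y (X n) \<omega>) \<longlonglongrightarrow> (LINT \<omega>|M. Y a \<omega>)"
    proof (rule integral_dominated_convergence[where w="\<lambda>_. K"])
      show "AE \<omega> in M. (\<lambda>n. Y (X n) \<omega>) \<longlonglongrightarrow> Y a \<omega>"
        using cont
      proof eventually_elim
        case (elim \<omega>)
        then show ?case using a unfolding continuous_on_sequentially comp_def by blast
      qed
    qed (use a Y bound in auto)
    then show "((\<lambda>u. LINT \<omega>|M. Y u \<omega>) \<circ> X) \<longlonglongrightarrow> (LINT \<omega>|M. Y a \<omega>)"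
      by (simp add: comp_def)
  qed
qed

lemma (in prob_space) abs_expectation_le:
  fixes h :: "'a \<Rightarrow> real"
  assumes "h \<in> borel_measurable M" "\<And>\<omega>. \<omega> \<in> space M \<Longrightarrow> \<bar>h \<omega>\<bar> \<le> K"
  shows "\<bar>LINT \<omega>|M. h \<omega>\<bar> \<le> K"
proof -
  have "integrable M h" by (rule integrable_const_bound[where B=K]) (use assms in auto)
  then have "(LINT \<omega>|M. \<bar>h \<omega>\<bar>) \<le> (LINT \<omega>|M. K)"
    by (intro integral_mono) (use assms in auto)
  then have "(LINT \<omega>|M. \<bar>h \<omega>\<bar>) \<le> K" by (simp add: prob_space)
  then show ?thesis by (rule order_trans[OF integral_abs_bound])
qed

text \<open>
  Time is integrated path by path, and the result is measurable as a limit of Riemann sums. Since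
  these use \<open>Y u\<close> for \<open>u \<le> t\<close> only, the lemma also gives adaptedness, by taking for \<open>M\<close> the
  \<open>\<sigma>\<close>-algebra at time \<open>t\<close>.
\<close>

lemma integral_process_measurable:
  fixes Y :: "real \<Rightarrow> 'a \<Rightarrow> real"
  assumes Y: "\<And>u. u \<in> {0..t} \<Longrightarrow> Y u \<in> borel_measurable M"
    and cont: "\<And>\<omega>. \<omega> \<in> space M \<Longrightarrow> continuous_on {0..t} (\<lambda>u. Y u \<omega>)"
    and t: "t \<ge> 0"
  shows "(\<lambda>\<omega>. integral {0..t} (\<lambda>u. Y u \<omega>)) \<in> borel_measurable M"
proof (cases "t = 0")
  case True
  then show ?thesis by simp
next
  case False
  with t have t: "t > 0" by simp
  show ?thesis
  proof (rule borel_measurable_LIMSEQ_real)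
    show "(\<lambda>n. \<Sum>k<n. Y (t * real k / real n) \<omega> * (t / real n)) \<longlonglongrightarrow> integral {0..t} (\<lambda>u. Y u \<omega>)"
      if "\<omega> \<in> space M" for \<omega>
      by (rule riemann_sums_tendsto[OF t cont[OF that]])
    show "(\<lambda>\<omega>. \<Sum>k<n. Y (t * real k / real n) \<omega> * (t / real n)) \<in> borel_measurable M" for n
    proof (intro borel_measurable_sum borel_measurable_times Y borel_measurable_const)
      fix k assume "k \<in> {..<n}"
      then show "t * real k / real n \<in> {0..t}"
        using grid_bounds[of t k n] t by auto
    qed
  qed
qed

text \<open>
  Both sides are limits of expectations of Riemann sums, so continuity of the paths replaces the
  joint measurability in time and \<open>\<omega>\<close> that Fubini's theorem asks for.
\<close>

lemma expectation_integral_swap: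
  fixes Y :: "real \<Rightarrow> 'a \<Rightarrow> real"
  assumes M: "prob_space M" and t: "t \<ge> 0"
    and Y: "\<And>u. u \<in> {0..t} \<Longrightarrow> Y u \<in> borel_measurable M"
    and bound: "\<And>u \<omega>. u \<in> {0..t} \<Longrightarrow> \<omega> \<in> space M \<Longrightarrow> \<bar>Y u \<omega>\<bar> \<le> K"
    and cont: "\<And>\<omega>. \<omega> \<in> space M \<Longrightarrow> continuous_on {0..t} (\<lambda>u. Y u \<omega>)"
  shows "(LINT \<omega>|M. integral {0..t} (\<lambda>u. Y u \<omega>)) = integral {0..t} (\<lambda>u. LINT \<omega>|M. Y u \<omega>)"
proof (cases "t = 0")
  case True
  then show ?thesis by simp
next
  case False
  with t have t: "t > 0" by simp
  interpret prob_space M by fact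
  let ?g = "\<lambda>n k. t * real k / real n"
  have g_in: "?g n k \<in> {0..t}" if "k < n" for n k
    using grid_bounds[of t k n] t that by auto
  have Yi: "integrable M (Y u)" if "u \<in> {0..t}" for u
    by (rule integrable_const_bound[where B=K]) (use Y bound that in auto)
  have "(\<lambda>n. LINT \<omega>|M. (\<Sum>k<n. Y (?g n k) \<omega> * (t / real n)))
      \<longlonglongrightarrow> (LINT \<omega>|M. integral {0..t} (\<lambda>u. Y u \<omega>))"
  proof (rule integral_dominated_convergence[where w="\<lambda>_. K * t"])
    show "(\<lambda>\<omega>. integral {0..t} (\<lambda>u. Y u \<omega>)) \<in> borel_measurable M"
      by (rule integral_process_measurable[OF Y cont less_imp_le[OF t]])
    show "(\<lambda>\<omega>. \<Sum>k<n. Y (?g n k) \<omega> * (t / real n)) \<in> borel_measurable M" for n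
      by (intro borel_measurable_sum borel_measurable_times Y borel_measurable_const g_in) auto
    show "AE \<omega> in M. (\<lambda>n. \<Sum>k<n. Y (?g n k) \<omega> * (t / real n)) \<longlonglongrightarrow> integral {0..t} (\<lambda>u. Y u \<omega>)"
      by (intro AE_I2 riemann_sums_tendsto[OF t cont])
    show "AE \<omega> in M. norm (\<Sum>k<n. Y (?g n k) \<omega> * (t / real n)) \<le> K * t" for n
    proof (rule AE_I2)
      fix \<omega> assume \<omega>: "\<omega> \<in> space M"
      have K: "0 \<le> K" using bound[of 0 \<omega>] \<omega> t by (simp add: order_trans[OF abs_ge_zero])
      have h: "0 \<le> t / real n" using t by simp
      have "\<bar>\<Sum>k<n. Y (?g n k) \<omega> * (t / real n)\<bar> \<le> (\<Sum>k<n. K * (t / real n))"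
      proof (rule order_trans[OF sum_abs sum_mono])
        fix k assume "k \<in> {..<n}"
        then have k: "k < n" by simp
        show "\<bar>Y (?g n k) \<omega> * (t / real n)\<bar> \<le> K * (t / real n)"
          unfolding abs_mult abs_of_nonneg[OF h] by (rule mult_right_mono[OF bound[OF g_in[OF k] \<omega>] h])
      qed
      also have "\<dots> \<le> K * t" using K t by (cases "n = 0") auto
      finally show "norm (\<Sum>k<n. Y (?g n k) \<omega> * (t / real n)) \<le> K * t" by simp
    qed
  qed simp
  moreover have "(LINT \<omega>|M. (\<Sum>k<n. Y (?g n k) \<omega> * (t / real n)))
      = (\<Sum>k<n. (LINT \<omega>|M. Y (?g n k) \<omega>) * (t / real n))" for n
    using Yi g_in by (subst Bochner_Integration.integral_sum) auto
  moreover have "(\<lambda>n. \<Sum>k<n. (LINT \<omega>|M. Y (?g n k) \<omega>) * (t / real n))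
      \<longlonglongrightarrow> integral {0..t} (\<lambda>u. LINT \<omega>|M. Y u \<omega>)"
    by (intro riemann_sums_tendsto[OF t] expectation_continuous_on[OF M Y bound] AE_I2 cont)
  ultimately show ?thesis by (auto intro: LIMSEQ_unique)
qed

section \<open>Increasing paths with a density\<close>

text \<open>
  \<open>C\<close> is an antiderivative on \<open>[0, t]\<close> of the integrable density \<open>c \<ge> 0\<close>. The density may be
  discontinuous and unbounded, as \<open>coth (R u)\<close> is at the zeros of \<open>R\<close>; hence only integrals of \<open>c\<close>
  over intervals are used, never a derivative of \<open>C\<close>.
\<close>

definition has_rate :: "real \<Rightarrow> (real \<Rightarrow> real) \<Rightarrow> (real \<Rightarrow> real) \<Rightarrow> bool" where
  "has_rate t C c \<longleftrightarrow> c integrable_on {0..t} \<and> (\<forall>u\<in>{0..t}. 0 \<le> c u) \<and>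
    (\<forall>r s. 0 \<le> r \<longrightarrow> r \<le> s \<longrightarrow> s \<le> t \<longrightarrow> C s - C r = integral {r..s} c)"

lemma has_rateD:
  assumes "has_rate t C c"
  shows "c integrable_on {0..t}" "u \<in> {0..t} \<Longrightarrow> 0 \<le> c u"
    "0 \<le> r \<Longrightarrow> r \<le> s \<Longrightarrow> s \<le> t \<Longrightarrow> C s - C r = integral {r..s} c"
  using assms unfolding has_rate_def by blast+

lemma has_rateI:
  assumes "c integrable_on {0..t}" "\<And>u. u \<in> {0..t} \<Longrightarrow> 0 \<le> c u"
    "\<And>s. s \<in> {0..t} \<Longrightarrow> C s = a + integral {0..s} c"
  shows "has_rate t C c"
  unfolding has_rate_def
proof (intro conjI allI impI)
  fix r s assume rs: "0 \<le> r" "r \<le> s" "s \<le> t"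
  have "c integrable_on {0..s}"
    by (rule integrable_on_subinterval[OF assms(1)]) (use rs in auto)
  from Henstock_Kurzweil_Integration.integral_combine[OF rs(1,2) this] assms(3)[of r] assms(3)[of s] rs
  show "C s - C r = integral {r..s} c" by simp
qed (use assms in auto)

lemma has_rate_mono:
  assumes "has_rate t C c" "0 \<le> r" "r \<le> s" "s \<le> t"
  shows "C r \<le> C s"
proof -
  have "c integrable_on {r..s}"
    by (rule integrable_on_subinterval[OF has_rateD(1)[OF assms(1)]]) (use assms in auto)
  then have "0 \<le> integral {r..s} c"
    by (rule integral_nonneg) (use assms has_rateD(2)[OF assms(1)] in auto)
  then show ?thesis using has_rateD(3)[OF assms] by simp
qed

lemma has_rate_continuous:
  assumes "has_rate t C c"
  shows "continuous_on {0..t} C"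
proof -
  have "continuous_on {0..t} (\<lambda>s. C 0 + integral {0..s} c)"
    by (intro continuous_intros indefinite_integral_continuous_1 has_rateD(1)[OF assms])
  moreover have "C 0 + integral {0..s} c = C s" if "s \<in> {0..t}" for s
    using has_rateD(3)[OF assms, of 0 s] that by simp
  ultimately show ?thesis using continuous_on_eq by blast
qed

lemma has_rate_subset:
  assumes "has_rate t C c" "s \<le> t"
  shows "has_rate s C c"
  unfolding has_rate_def
proof (intro conjI ballI allI impI)
  show "c integrable_on {0..s}"
    by (rule integrable_on_subinterval[OF has_rateD(1)[OF assms(1)]]) (use assms(2) in auto)
qed (use has_rateD(2,3)[OF assms(1)] assms(2) in auto)

lemma exp_minus_lipschitz:
  fixes x y :: real
  assumes "0 \<le> x" "0 \<le> y"
  shows "\<bar>exp (- x) - exp (- y)\<bar> \<le> \<bar>x - y\<bar>"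
proof -
  have "norm (exp (- x) - exp (- y)) \<le> 1 * norm (x - y)"
    by (rule field_differentiable_bound[of "{0..}" "\<lambda>x. exp (- x)" "\<lambda>x. - exp (- x)"])
      (use assms in \<open>auto intro!: derivative_eq_intros\<close>)
  then show ?thesis by simp
qed

lemma exp_weight_step:
  fixes a b :: real
  shows "exp (- b) * (b - a) \<le> exp (- a) - exp (- b)"
proof -
  have "exp (- b) * (1 + (b - a)) \<le> exp (- b) * exp (b - a)"
    by (intro mult_left_mono exp_ge_add_one_self) simp
  also have "\<dots> = exp (- a)" by (simp add: exp_add[symmetric])
  finally show ?thesis by (simp add: algebra_simps)
qed

text \<open>
  These sums are dominated by a telescoping one, because \<open>exp (- D) dD\<close> is the differential of
  \<open>- exp (- D)\<close>. So they are bounded by \<open>1\<close> when \<open>D 0 \<ge> 0\<close>, however large \<open>D t\<close> is: this is how an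
  exponential weight controls an increasing path without bounds on its moments.
\<close>

lemma exp_weight_sum:
  fixes D :: "real \<Rightarrow> real"
  assumes "n > 0"
  shows "(\<Sum>k<n. exp (- D (t * real (Suc k) / real n)) * (D (t * real (Suc k) / real n) - D (t * real k / real n)))
    \<le> exp (- D 0) - exp (- D t)"
proof -
  have "(\<Sum>k<n. exp (- D (t * real (Suc k) / real n)) * (D (t * real (Suc k) / real n) - D (t * real k / real n)))
    \<le> (\<Sum>k<n. exp (- D (t * real k / real n)) - exp (- D (t * real (Suc k) / real n)))"
    by (intro sum_mono exp_weight_step)
  also have "\<dots> = exp (- D (t * real 0 / real n)) - exp (- D (t * real n / real n))"
    by (rule sum_lessThan_telescope')
  finally show ?thesis using assms by simp
qed

lemma exp_weight_integral:
  assumes t: "t > 0" and D: "has_rate t D d"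
  shows "integral {0..t} (\<lambda>u. exp (- D u) * d u) \<le> exp (- D 0) - exp (- D t)"
proof -
  let ?g = "\<lambda>n k. t * real k / real n"
  note gb = grid_bounds[OF less_imp_le[OF t]]
  have c: "continuous_on {0..t} (\<lambda>u. exp (- D u))"
    by (intro continuous_intros has_rate_continuous[OF D])
  have "(\<lambda>n. \<Sum>k<n. exp (- D (?g n (Suc k))) * integral {?g n k..?g n (Suc k)} d)
      \<longlonglongrightarrow> integral {0..t} (\<lambda>u. exp (- D u) * d u)"
  proof (rule tagged_sums_tendsto[OF t c has_rateD(1,2)[OF D]])
    fix e :: real assume "e > 0"
    from uniformly_continuous_grid[OF t c this]
    show "\<forall>\<^sub>F n in sequentially. \<forall>k<n. \<forall>u\<in>{?g n k..?g n (Suc k)}.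
        \<bar>exp (- D (?g n (Suc k))) - exp (- D u)\<bar> \<le> e"
    proof eventually_elim
      case (elim n)
      show ?case
      proof (intro allI impI ballI)
        fix k u assume k: "k < n" and u: "u \<in> {?g n k..?g n (Suc k)}"
        have "?g n (Suc k) \<in> {?g n k..?g n (Suc k)}" using gb(2)[OF k] by auto
        with elim k u show "\<bar>exp (- D (?g n (Suc k))) - exp (- D u)\<bar> \<le> e"
          by (blast intro: less_imp_le)
      qed
    qed
  qed auto
  moreover have "\<forall>\<^sub>F n in sequentially.
      (\<Sum>k<n. exp (- D (?g n (Suc k))) * integral {?g n k..?g n (Suc k)} d) \<le> exp (- D 0) - exp (- D t)"
    using eventually_gt_at_top[of 0]
  proof eventually_elim
    case (elim n)
    have "(\<Sum>k<n. exp (- D (?g n (Suc k))) * integral {?g n k..?g n (Suc k)} d)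
      = (\<Sum>k<n. exp (- D (?g n (Suc k))) * (D (?g n (Suc k)) - D (?g n k)))"
    proof (rule sum.cong[OF refl])
      fix k assume "k \<in> {..<n}"
      then have k: "k < n" by simp
      show "exp (- D (?g n (Suc k))) * integral {?g n k..?g n (Suc k)} d
        = exp (- D (?g n (Suc k))) * (D (?g n (Suc k)) - D (?g n k))"
        unfolding has_rateD(3)[OF D gb[OF k]] ..
    qed
    then show ?case using exp_weight_sum[OF elim, of D t] by simp
  qed
  ultimately show ?thesis by (intro tendsto_upperbound[OF _ _ sequentially_bot])
qed

section \<open>Test functions and the finite-variation part of an increment\<close>

text \<open>
  Three bounded derivatives suffice for the Taylor remainder in \<open>one_step_estimate\<close>, where the third
  absolute moment of an increment is integrable. A single constant for all bounds is enough, as only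
  limits are taken.
\<close>

locale C3_bounded =
  fixes f f1 f2 f3 :: "real \<Rightarrow> real" and K :: real
  assumes f_deriv: "(f has_real_derivative f1 x) (at x)" "(f1 has_real_derivative f2 x) (at x)"
      "(f2 has_real_derivative f3 x) (at x)"
    and f_bound: "\<bar>f x\<bar> \<le> K" "\<bar>f1 x\<bar> \<le> K" "\<bar>f2 x\<bar> \<le> K" "\<bar>f3 x\<bar> \<le> K"
begin

lemma K_nonneg: "0 \<le> K"
  using f_bound(1)[of 0] by linarith

lemma f_continuous: "continuous_on S f" "continuous_on S f1" "continuous_on S f2"
  by (rule DERIV_continuous_on[OF has_field_derivative_at_within[OF f_deriv(1)]]
    DERIV_continuous_on[OF has_field_derivative_at_within[OF f_deriv(2)]]
    DERIV_continuous_on[OF has_field_derivative_at_within[OF f_deriv(3)]])+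

lemma f_measurable [measurable]: "f \<in> borel_measurable borel" "f1 \<in> borel_measurable borel"
  "f2 \<in> borel_measurable borel"
  by (rule borel_measurable_continuous_onI, rule f_continuous)+

lemma f1_lipschitz: "\<bar>f1 x - f1 y\<bar> \<le> K * \<bar>x - y\<bar>"
proof -
  have "norm (f1 x - f1 y) \<le> K * norm (x - y)"
    by (rule field_differentiable_bound[of UNIV _ f2])
      (use f_deriv(2) f_bound(3) in \<open>auto intro: DERIV_subset\<close>)
  then show ?thesis by simp
qed

lemma f_lipschitz: "\<bar>f x - f y\<bar> \<le> K * \<bar>x - y\<bar>"
proof -
  have "norm (f x - f y) \<le> K * norm (x - y)"
    by (rule field_differentiable_bound[of UNIV _ f1])
      (use f_deriv(1) f_bound(2) in \<open>auto intro: DERIV_subset\<close>)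
  then show ?thesis by simp
qed

lemma taylor: "\<bar>f (x + z) - f x - f1 x * z - f2 x * z\<^sup>2 / 2\<bar> \<le> K * \<bar>z\<bar> ^ 3 / 2"
proof -
  define g where "g i = (if i = 0 then f else if i = 1 then f1 else if i = 2 then f2 else f3)" for i :: nat
  have "norm (g 0 (x + z) - (\<Sum>i\<le>2. g i x * (x + z - x) ^ i / fact i))
      \<le> K * norm (x + z - x) ^ Suc 2 / fact 2"
  proof (rule field_Taylor[of UNIV])
    fix i y assume "i \<le> (2::nat)"
    then have "i = 0 \<or> i = 1 \<or> i = 2" by linarith
    then show "(g i has_field_derivative g (Suc i) y) (at y within UNIV)"
      using f_deriv by (auto simp: g_def)
  qed (use f_bound in \<open>auto simp: g_def\<close>)
  then show ?thesis by (simp add: g_def numeral_2_eq_2 numeral_3_eq_3 algebra_simps)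
qed

end

lemma mvt_closed:
  fixes f :: "real \<Rightarrow> real"
  assumes "\<And>x. (f has_real_derivative f' x) (at x)" "a \<le> b"
  obtains z where "a \<le> z" "z \<le> b" "f b - f a = f' z * (b - a)"
proof (cases "a = b")
  case True
  then show ?thesis using that[of a] by simp
next
  case False
  with assms(2) have "a < b" by simp
  from MVT2[OF this, of f f'] assms(1) obtain z where "a < z" "z < b" "f b - f a = (b - a) * f' z"
    by blast
  then show ?thesis using that[of z] by (simp add: mult.commute)
qed

context C3_bounded
begin

text \<open>
  The move of the part of finite variation, with the Brownian coordinate \<open>b\<close> frozen at its new value:
  first \<open>C\<close> moves, under the new weight, then the weight \<open>exp (- D)\<close>.
\<close>

lemma fv_step:
  assumes "Ca \<le> Cb" "Da \<le> Db"
  obtains \<xi> \<zeta> where "Ca \<le> \<xi>" "\<xi> \<le> Cb" "Da \<le> \<zeta>" "\<zeta> \<le> Db"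
    "f (b + Cb) * exp (- Db) - f (b + Ca) * exp (- Da)
      = f1 (b + \<xi>) * exp (- Db) * (Cb - Ca) + (- f (b + Ca) * exp (- \<zeta>)) * (Db - Da)"
proof -
  have "((\<lambda>x. f (b + x)) has_real_derivative f1 (b + x)) (at x)" for x
  proof -
    have "((\<lambda>x. b + x) has_real_derivative 1) (at x)" by (auto intro!: derivative_eq_intros)
    from DERIV_chain2[OF f_deriv(1) this] show ?thesis by simp
  qed
  from mvt_closed[OF this assms(1)] obtain \<xi> where \<xi>: "Ca \<le> \<xi>" "\<xi> \<le> Cb"
    "f (b + Cb) - f (b + Ca) = f1 (b + \<xi>) * (Cb - Ca)" by blast
  have "((\<lambda>x. exp (- x)) has_real_derivative - exp (- x)) (at x)" for x :: real
    by (auto intro!: derivative_eq_intros)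
  from mvt_closed[OF this assms(2)] obtain \<zeta> where \<zeta>: "Da \<le> \<zeta>" "\<zeta> \<le> Db"
    "exp (- Db) - exp (- Da) = - exp (- \<zeta>) * (Db - Da)" by blast
  have "f (b + Cb) * exp (- Db) - f (b + Ca) * exp (- Da)
     = (f (b + Cb) - f (b + Ca)) * exp (- Db) + f (b + Ca) * (exp (- Db) - exp (- Da))"
    by (simp add: algebra_simps)
  also have "\<dots> = f1 (b + \<xi>) * exp (- Db) * (Cb - Ca) + (- f (b + Ca) * exp (- \<zeta>)) * (Db - Da)"
    unfolding \<xi>(3) \<zeta>(3) by (simp add: algebra_simps)
  finally show ?thesis using that \<xi>(1,2) \<zeta>(1,2) by blast
qed

text \<open>
  The chain rule for \<open>f (B + C) exp (- D)\<close> along the part of finite variation. By the mean value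
  theorem the sum is a pair of tagged sums against \<open>c\<close> and \<open>d\<close>. Each of their tags evaluates the
  integrand at times and intermediate points of one cell, so uniform continuity of the three paths
  makes it uniformly close to the integrand.
\<close>

lemma fv_sums_tendsto:
  assumes t: "t > 0" and b: "continuous_on {0..t} b"
    and C: "has_rate t C c" and D: "has_rate t D d" and D0: "0 \<le> D 0"
  defines "S \<equiv> \<lambda>n. \<Sum>k<n.
      f (b (t * real (Suc k) / real n) + C (t * real (Suc k) / real n)) * exp (- D (t * real (Suc k) / real n))
    - f (b (t * real (Suc k) / real n) + C (t * real k / real n)) * exp (- D (t * real k / real n))"
  shows "S \<longlonglongrightarrow> integral {0..t} (\<lambda>u. (f1 (b u + C u) * exp (- D u)) * c u)
    + integral {0..t} (\<lambda>u. (- f (b u + C u) * exp (- D u)) * d u)"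
proof -
  let ?g = "\<lambda>n k. t * real k / real n"
  let ?I = "\<lambda>n k. {?g n k..?g n (Suc k)}"
  note gb = grid_bounds[OF less_imp_le[OF t]]
  have Cm: "C r \<le> C s" if "0 \<le> r" "r \<le> s" "s \<le> t" for r s using has_rate_mono[OF C that] .
  have Dm: "D r \<le> D s" if "0 \<le> r" "r \<le> s" "s \<le> t" for r s using has_rate_mono[OF D that] .
  have Cc: "continuous_on {0..t} C" and Dc: "continuous_on {0..t} D"
    using has_rate_continuous C D by auto
  define Q where "Q n k \<xi> \<zeta> \<longleftrightarrow>
     C (?g n k) \<le> \<xi> \<and> \<xi> \<le> C (?g n (Suc k)) \<and> D (?g n k) \<le> \<zeta> \<and> \<zeta> \<le> D (?g n (Suc k)) \<and>
     f (b (?g n (Suc k)) + C (?g n (Suc k))) * exp (- D (?g n (Suc k)))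
      - f (b (?g n (Suc k)) + C (?g n k)) * exp (- D (?g n k))
      = f1 (b (?g n (Suc k)) + \<xi>) * exp (- D (?g n (Suc k))) * (C (?g n (Suc k)) - C (?g n k))
      + (- f (b (?g n (Suc k)) + C (?g n k)) * exp (- \<zeta>)) * (D (?g n (Suc k)) - D (?g n k))" for n k \<xi> \<zeta>
  have "\<exists>\<xi> \<zeta>. Q n k \<xi> \<zeta>" if "k < n" for n k
    using fv_step[OF Cm[OF gb[OF that]] Dm[OF gb[OF that]], of "b (?g n (Suc k))"]
    unfolding Q_def by blast
  then have "\<forall>n k. \<exists>\<xi> \<zeta>. k < n \<longrightarrow> Q n k \<xi> \<zeta>" by blast
  then have "\<exists>\<xi> \<zeta>. \<forall>n k. k < n \<longrightarrow> Q n k (\<xi> n k) (\<zeta> n k)"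
    unfolding choice_iff .
  then obtain \<xi> \<zeta> where Q: "\<And>n k. k < n \<Longrightarrow> Q n k (\<xi> n k) (\<zeta> n k)"
    by blast
  have \<xi>: "C (?g n k) \<le> \<xi> n k" "\<xi> n k \<le> C (?g n (Suc k))"
    and \<zeta>: "D (?g n k) \<le> \<zeta> n k" "\<zeta> n k \<le> D (?g n (Suc k))"
    and eq: "f (b (?g n (Suc k)) + C (?g n (Suc k))) * exp (- D (?g n (Suc k)))
      - f (b (?g n (Suc k)) + C (?g n k)) * exp (- D (?g n k))
      = f1 (b (?g n (Suc k)) + \<xi> n k) * exp (- D (?g n (Suc k))) * (C (?g n (Suc k)) - C (?g n k))
      + (- f (b (?g n (Suc k)) + C (?g n k)) * exp (- \<zeta> n k)) * (D (?g n (Suc k)) - D (?g n k))"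
    if "k < n" for n k
    using Q[OF that] unfolding Q_def by blast+
  have S: "S n = (\<Sum>k<n. (f1 (b (?g n (Suc k)) + \<xi> n k) * exp (- D (?g n (Suc k)))) * integral (?I n k) c)
      + (\<Sum>k<n. (- f (b (?g n (Suc k)) + C (?g n k)) * exp (- \<zeta> n k)) * integral (?I n k) d)" for n
    unfolding S_def sum.distrib[symmetric]
  proof (rule sum.cong[OF refl])
    fix k assume "k \<in> {..<n}"
    then have k: "k < n" by simp
    show "f (b (?g n (Suc k)) + C (?g n (Suc k))) * exp (- D (?g n (Suc k)))
      - f (b (?g n (Suc k)) + C (?g n k)) * exp (- D (?g n k)) =
      (f1 (b (?g n (Suc k)) + \<xi> n k) * exp (- D (?g n (Suc k)))) * integral (?I n k) c
      + (- f (b (?g n (Suc k)) + C (?g n k)) * exp (- \<zeta> n k)) * integral (?I n k) d"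
      unfolding eq[OF k] has_rateD(3)[OF C gb[OF k], symmetric]
        has_rateD(3)[OF D gb[OF k], symmetric] ..
  qed
  \<comment> \<open>the three path oscillations on a cell, together with the position of the values inside a cell\<close>
  have close: "\<forall>\<^sub>F n in sequentially. \<forall>k<n. \<forall>u\<in>?I n k.
      \<bar>b (?g n (Suc k)) - b u\<bar> < e \<and> \<bar>C (?g n (Suc k)) - C (?g n k)\<bar> < e \<and>
      \<bar>D (?g n (Suc k)) - D (?g n k)\<bar> < e \<and> C (?g n k) \<le> C u \<and> C u \<le> C (?g n (Suc k)) \<and>
      D (?g n k) \<le> D u \<and> D u \<le> D (?g n (Suc k)) \<and> 0 \<le> D (?g n k)" if "e > 0" for e
    using uniformly_continuous_grid[OF t b that] uniformly_continuous_grid[OF t Cc that]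
      uniformly_continuous_grid[OF t Dc that]
  proof eventually_elim
    case (elim n)
    show ?case
    proof (intro allI impI ballI)
      fix k u assume k: "k < n" and u: "u \<in> ?I n k"
      note gk = gb[OF k]
      have "0 \<le> D (?g n k)" using D0 Dm[of 0 "?g n k"] gk by linarith
      moreover have "?g n k \<in> ?I n k" "?g n (Suc k) \<in> ?I n k" using gk by auto
      ultimately show "\<bar>b (?g n (Suc k)) - b u\<bar> < e \<and> \<bar>C (?g n (Suc k)) - C (?g n k)\<bar> < e \<and>
      \<bar>D (?g n (Suc k)) - D (?g n k)\<bar> < e \<and> C (?g n k) \<le> C u \<and> C u \<le> C (?g n (Suc k)) \<and>
      D (?g n k) \<le> D u \<and> D u \<le> D (?g n (Suc k)) \<and> 0 \<le> D (?g n k)"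
        using elim k u gk by (auto intro!: Cm Dm)
    qed
  qed
  have step: "\<bar>h p * exp (- q) - h p' * exp (- q')\<bar> \<le> K * (\<bar>p - p'\<bar> + \<bar>q - q'\<bar>)"
    if "0 \<le> q" "0 \<le> q'" "\<And>x. \<bar>h x\<bar> \<le> K" "\<And>x y. \<bar>h x - h y\<bar> \<le> K * \<bar>x - y\<bar>"
    for p p' q q' :: real and h :: "real \<Rightarrow> real"
  proof -
    have "h p * exp (- q) - h p' * exp (- q')
        = (h p - h p') * exp (- q) + h p' * (exp (- q) - exp (- q'))"
      by (simp add: algebra_simps)
    then have "\<bar>h p * exp (- q) - h p' * exp (- q')\<bar>
        \<le> \<bar>h p - h p'\<bar> * exp (- q) + \<bar>h p'\<bar> * \<bar>exp (- q) - exp (- q')\<bar>"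
      using abs_triangle_ineq[of "(h p - h p') * exp (- q)" "h p' * (exp (- q) - exp (- q'))"]
      by (simp add: abs_mult)
    also have "\<dots> \<le> (K * \<bar>p - p'\<bar>) * 1 + K * \<bar>q - q'\<bar>"
      by (intro add_mono mult_mono exp_minus_lipschitz that) (use that K_nonneg in auto)
    finally show ?thesis by (simp add: algebra_simps)
  qed
  have K3: "K * (3 * (e / (3 * K + 1))) \<le> e" if "e > 0" for e
    using that K_nonneg by (simp add: field_simps)
  have lim1: "(\<lambda>n. \<Sum>k<n. (f1 (b (?g n (Suc k)) + \<xi> n k) * exp (- D (?g n (Suc k)))) * integral (?I n k) c)
      \<longlonglongrightarrow> integral {0..t} (\<lambda>u. (f1 (b u + C u) * exp (- D u)) * c u)"
  proof (rule tagged_sums_tendsto[OF t])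
    show "continuous_on {0..t} (\<lambda>u. f1 (b u + C u) * exp (- D u))"
      by (intro continuous_intros continuous_on_compose2[OF f_continuous(2)[of UNIV]] b Cc Dc) auto
    fix e :: real assume e: "e > 0"
    define e' where "e' = e / (3 * K + 1)"
    have e': "e' > 0" using e K_nonneg by (simp add: e'_def)
    show "\<forall>\<^sub>F n in sequentially. \<forall>k<n. \<forall>u\<in>?I n k.
        \<bar>f1 (b (?g n (Suc k)) + \<xi> n k) * exp (- D (?g n (Suc k))) - f1 (b u + C u) * exp (- D u)\<bar> \<le> e"
      using close[OF e']
    proof eventually_elim
      case (elim n)
      show ?case
      proof (intro allI impI ballI)
        fix k u assume k: "k < n" and u: "u \<in> ?I n k"
        note el = elim[rule_format, OF k u]
        have "\<bar>f1 (b (?g n (Suc k)) + \<xi> n k) * exp (- D (?g n (Suc k))) - f1 (b u + C u) * exp (- D u)\<bar>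
          \<le> K * (\<bar>b (?g n (Suc k)) + \<xi> n k - (b u + C u)\<bar> + \<bar>D (?g n (Suc k)) - D u\<bar>)"
          by (rule step[OF _ _ f_bound(2) f1_lipschitz]) (use el in auto)
        also have "\<dots> \<le> K * (3 * e')"
          using el \<xi>[OF k] K_nonneg by (intro mult_left_mono) auto
        also have "\<dots> \<le> e" unfolding e'_def by (rule K3[OF e])
        finally show "\<bar>f1 (b (?g n (Suc k)) + \<xi> n k) * exp (- D (?g n (Suc k))) - f1 (b u + C u) * exp (- D u)\<bar> \<le> e" .
      qed
    qed
  qed (use has_rateD[OF C] in auto)
  have lim2: "(\<lambda>n. \<Sum>k<n. (- f (b (?g n (Suc k)) + C (?g n k)) * exp (- \<zeta> n k)) * integral (?I n k) d)
      \<longlonglongrightarrow> integral {0..t} (\<lambda>u. (- f (b u + C u) * exp (- D u)) * d u)"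
  proof (rule tagged_sums_tendsto[OF t])
    show "continuous_on {0..t} (\<lambda>u. - f (b u + C u) * exp (- D u))"
      by (intro continuous_intros continuous_on_compose2[OF f_continuous(1)[of UNIV]] b Cc Dc) auto
    fix e :: real assume e: "e > 0"
    define e' where "e' = e / (3 * K + 1)"
    have e': "e' > 0" using e K_nonneg by (simp add: e'_def)
    show "\<forall>\<^sub>F n in sequentially. \<forall>k<n. \<forall>u\<in>?I n k.
        \<bar>- f (b (?g n (Suc k)) + C (?g n k)) * exp (- \<zeta> n k) - - f (b u + C u) * exp (- D u)\<bar> \<le> e"
      using close[OF e']
    proof eventually_elim
      case (elim n)
      show ?case
      proof (intro allI impI ballI)
        fix k u assume k: "k < n" and u: "u \<in> ?I n k"
        note el = elim[rule_format, OF k u]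
        have "\<bar>f (b (?g n (Suc k)) + C (?g n k)) * exp (- \<zeta> n k) - f (b u + C u) * exp (- D u)\<bar>
          \<le> K * (\<bar>b (?g n (Suc k)) + C (?g n k) - (b u + C u)\<bar> + \<bar>\<zeta> n k - D u\<bar>)"
          by (rule step[OF _ _ f_bound(1) f_lipschitz]) (use el \<zeta>[OF k] in auto)
        also have "\<dots> \<le> K * (3 * e')"
          using el \<zeta>[OF k] K_nonneg by (intro mult_left_mono) auto
        also have "\<dots> \<le> e" unfolding e'_def by (rule K3[OF e])
        finally show "\<bar>- f (b (?g n (Suc k)) + C (?g n k)) * exp (- \<zeta> n k) - - f (b u + C u) * exp (- D u)\<bar> \<le> e"
          by linarith
      qed
    qed
  qed (use has_rateD[OF D] in auto)
  show ?thesis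
    unfolding S by (rule tendsto_add[OF lim1 lim2])
qed

lemma fv_sums_bounded:
  assumes t: "t > 0"
    and C: "has_rate t C c" and D: "has_rate t D d" and D0: "0 \<le> D 0"
    and W: "(\<Sum>k<n. exp (- D (t * real (Suc k) / real n))
      * (C (t * real (Suc k) / real n) - C (t * real k / real n))) \<le> W"
  shows "\<bar>\<Sum>k<n.
      f (b (t * real (Suc k) / real n) + C (t * real (Suc k) / real n)) * exp (- D (t * real (Suc k) / real n))
    - f (b (t * real (Suc k) / real n) + C (t * real k / real n)) * exp (- D (t * real k / real n))\<bar>
    \<le> K * (W + 1)"
proof -
  let ?g = "\<lambda>k. t * real k / real n"
  note gb = grid_bounds[OF less_imp_le[OF t]]
  have "\<bar>f (b (?g (Suc k)) + C (?g (Suc k))) * exp (- D (?g (Suc k)))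
      - f (b (?g (Suc k)) + C (?g k)) * exp (- D (?g k))\<bar>
    \<le> K * (exp (- D (?g (Suc k))) * (C (?g (Suc k)) - C (?g k))
        + (exp (- D (?g k)) - exp (- D (?g (Suc k)))))" (is "?A \<le> _") if k: "k < n" for k
  proof -
    have Cm: "C (?g k) \<le> C (?g (Suc k))" and Dm: "D (?g k) \<le> D (?g (Suc k))"
      using has_rate_mono[OF C gb[OF k]] has_rate_mono[OF D gb[OF k]] by auto
    have "f (b (?g (Suc k)) + C (?g (Suc k))) * exp (- D (?g (Suc k)))
        - f (b (?g (Suc k)) + C (?g k)) * exp (- D (?g k))
      = exp (- D (?g (Suc k))) * (f (b (?g (Suc k)) + C (?g (Suc k))) - f (b (?g (Suc k)) + C (?g k)))
      - f (b (?g (Suc k)) + C (?g k)) * (exp (- D (?g k)) - exp (- D (?g (Suc k))))"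
      by (simp add: algebra_simps)
    then have "?A \<le> exp (- D (?g (Suc k))) * \<bar>f (b (?g (Suc k)) + C (?g (Suc k))) - f (b (?g (Suc k)) + C (?g k))\<bar>
      + \<bar>f (b (?g (Suc k)) + C (?g k))\<bar> * \<bar>exp (- D (?g k)) - exp (- D (?g (Suc k)))\<bar>"
      using abs_triangle_ineq4[of "exp (- D (?g (Suc k))) * (f (b (?g (Suc k)) + C (?g (Suc k))) - f (b (?g (Suc k)) + C (?g k)))"
        "f (b (?g (Suc k)) + C (?g k)) * (exp (- D (?g k)) - exp (- D (?g (Suc k))))"]
      by (simp add: abs_mult)
    also have "\<dots> \<le> exp (- D (?g (Suc k))) * (K * (C (?g (Suc k)) - C (?g k)))
      + K * (exp (- D (?g k)) - exp (- D (?g (Suc k))))"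
    proof (intro add_mono mult_mono f_bound order_refl)
      show "\<bar>f (b (?g (Suc k)) + C (?g (Suc k))) - f (b (?g (Suc k)) + C (?g k))\<bar> \<le> K * (C (?g (Suc k)) - C (?g k))"
        using f_lipschitz[of "b (?g (Suc k)) + C (?g (Suc k))" "b (?g (Suc k)) + C (?g k)"] Cm by simp
    qed (use Dm K_nonneg in auto)
    finally show ?thesis by (simp add: algebra_simps)
  qed
  then have "\<bar>\<Sum>k<n. f (b (?g (Suc k)) + C (?g (Suc k))) * exp (- D (?g (Suc k)))
      - f (b (?g (Suc k)) + C (?g k)) * exp (- D (?g k))\<bar>
    \<le> (\<Sum>k<n. K * (exp (- D (?g (Suc k))) * (C (?g (Suc k)) - C (?g k))
        + (exp (- D (?g k)) - exp (- D (?g (Suc k))))))"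
    by (intro order_trans[OF sum_abs sum_mono]) auto
  also have "\<dots> = K * ((\<Sum>k<n. exp (- D (?g (Suc k))) * (C (?g (Suc k)) - C (?g k)))
      + (\<Sum>k<n. exp (- D (?g k)) - exp (- D (?g (Suc k)))))"
    by (simp only: sum_distrib_left[symmetric] sum.distrib)
  also have "(\<Sum>k<n. exp (- D (?g k)) - exp (- D (?g (Suc k)))) = exp (- D (?g 0)) - exp (- D (?g n))"
    by (rule sum_lessThan_telescope')
  also have "\<dots> \<le> 1"
  proof -
    have "exp (- D (?g 0)) \<le> 1" "0 \<le> exp (- D (?g n))" using D0 by simp_all
    then show ?thesis by linarith
  qed
  finally show ?thesis using W K_nonneg
    by (smt (verit, ccfv_SIG) mult_left_mono)
qed

end

section \<open>Brownian increments and the Dynkin estimate\<close>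

context brownian_motion
begin

lemma adapted_measurable:
  assumes "X \<in> borel_measurable (F s)"
  shows "X \<in> borel_measurable M"
  by (rule measurable_from_subalg[OF subalgebra_F assms])

lemma measurable_later:
  assumes "X \<in> borel_measurable (F s)" "s \<le> s'"
  shows "X \<in> borel_measurable (F s')"
  using assms sets_F_mono[OF assms(2)] space_F unfolding measurable_def by auto

lemma increment_measurable:
  assumes "0 \<le> s" "s < s'"
  shows "(\<lambda>\<omega>. B s' \<omega> - B s \<omega>) \<in> borel_measurable M"
  using assms by (intro borel_measurable_diff adapted_measurable[OF adapted]) auto

text \<open>
  The only way in which the independence of the increments enters the proof.
\<close>

lemma expectation_mult_increment:
  fixes \<xi> :: "'a \<Rightarrow> real" and g :: "real \<Rightarrow> real"
  assumes s: "0 \<le> s" "s < s'" and \<xi>: "\<xi> \<in> borel_measurable (F s)" "integrable M \<xi>"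
    and g: "g \<in> borel_measurable borel" "integrable M (\<lambda>\<omega>. g (B s' \<omega> - B s \<omega>))"
  shows "integrable M (\<lambda>\<omega>. \<xi> \<omega> * g (B s' \<omega> - B s \<omega>))"
    and "(LINT \<omega>|M. \<xi> \<omega> * g (B s' \<omega> - B s \<omega>)) = (LINT \<omega>|M. \<xi> \<omega>) * (LINT \<omega>|M. g (B s' \<omega> - B s \<omega>))"
proof -
  let ?Z = "\<lambda>\<omega>. B s' \<omega> - B s \<omega>"
  have "indep_set (sigma_sets (space M) {\<xi> -` A \<inter> space M | A. A \<in> sets borel})
      (sigma_sets (space M) {?Z -` A \<inter> space M | A. A \<in> sets borel})"
    unfolding indep_set_def
  proof (rule indep_sets_mono_sets[OF indep_increments[OF s, unfolded indep_set_def]])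
    have "sigma_sets (space M) {\<xi> -` A \<inter> space M | A. A \<in> sets borel} \<subseteq> sets (F s)"
      using sets.sigma_sets_subset[of "{\<xi> -` A \<inter> space M | A. A \<in> sets borel}" "F s"]
        measurable_sets[OF \<xi>(1)] space_F by auto
    then show "(case i of True \<Rightarrow> sigma_sets (space M) {\<xi> -` A \<inter> space M | A. A \<in> sets borel}
        | False \<Rightarrow> sigma_sets (space M) {?Z -` A \<inter> space M | A. A \<in> sets borel})
      \<subseteq> (case i of True \<Rightarrow> sets (F s) | False \<Rightarrow> sets (vimage_algebra (space M) ?Z borel))" for i
      by (cases i) (simp_all add: sets_vimage_algebra)
  qed
  then have "indep_var borel \<xi> borel ?Z"
    unfolding indep_var_eq using adapted_measurable[OF \<xi>(1)] increment_measurable[OF s] by simp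
  from indep_var_compose[OF this measurable_ident g(1)]
  have ind: "indep_var borel \<xi> borel (\<lambda>\<omega>. g (?Z \<omega>))" by (simp add: comp_def id_def)
  show "integrable M (\<lambda>\<omega>. \<xi> \<omega> * g (?Z \<omega>))"
    by (rule indep_var_integrable[OF ind \<xi>(2) g(2)])
  show "(LINT \<omega>|M. \<xi> \<omega> * g (?Z \<omega>)) = (LINT \<omega>|M. \<xi> \<omega>) * (LINT \<omega>|M. g (?Z \<omega>))"
    by (rule indep_var_lebesgue_integral[OF ind \<xi>(2) g(2)])
qed

lemma increment_moments:
  assumes s: "0 \<le> s" "s < s'"
  defines "Z \<equiv> \<lambda>\<omega>. B s' \<omega> - B s \<omega>"
  shows "integrable M Z" "(LINT \<omega>|M. Z \<omega>) = 0"
    and "integrable M (\<lambda>\<omega>. (Z \<omega>)\<^sup>2)" "(LINT \<omega>|M. (Z \<omega>)\<^sup>2) = s' - s"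
    and "integrable M (\<lambda>\<omega>. \<bar>Z \<omega>\<bar> ^ 3)"
      "(LINT \<omega>|M. \<bar>Z \<omega>\<bar> ^ 3) \<le> 2 * ((s' - s) * sqrt (s' - s))"
proof -
  define \<sigma> where "\<sigma> = sqrt (s' - s)"
  have \<sigma>: "\<sigma> > 0" "\<sigma>\<^sup>2 = s' - s" using s by (auto simp: \<sigma>_def)
  have dist: "distributed M lborel Z (normal_density 0 \<sigma>)"
    unfolding Z_def \<sigma>_def by (rule normal_increments[OF s])
  have tr: "integrable M (\<lambda>\<omega>. g (Z \<omega>)) \<and> (LINT \<omega>|M. g (Z \<omega>)) = v"
    if "has_bochner_integral lborel (\<lambda>x. normal_density 0 \<sigma> x * g x) v" "g \<in> borel_measurable borel"
    for g and v :: real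
    using distributed_integrable[OF dist, of g] distributed_integral[OF dist, of g] that
      has_bochner_integral_iff[of lborel "\<lambda>x. normal_density 0 \<sigma> x * g x" v] by simp
  show "integrable M Z" "(LINT \<omega>|M. Z \<omega>) = 0"
    using tr[of "\<lambda>x. x" 0] normal_moment_odd[OF \<sigma>(1), of 0 0] by simp_all
  show "integrable M (\<lambda>\<omega>. (Z \<omega>)\<^sup>2)" "(LINT \<omega>|M. (Z \<omega>)\<^sup>2) = s' - s"
    using tr[of "\<lambda>x. x\<^sup>2" "\<sigma>\<^sup>2"] normal_moment_even[OF \<sigma>(1), of 0 1] \<sigma>
    by (simp_all add: diff_divide_distrib)
  have 3: "integrable M (\<lambda>\<omega>. \<bar>Z \<omega>\<bar> ^ 3) \<and> (LINT \<omega>|M. \<bar>Z \<omega>\<bar> ^ 3) = 2 * \<sigma> ^ 3 * sqrt (2 / pi)"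
    using tr[of "\<lambda>x. \<bar>x\<bar> ^ 3"] normal_moment_abs_odd[OF \<sigma>(1), of 0 1] by simp
  then show "integrable M (\<lambda>\<omega>. \<bar>Z \<omega>\<bar> ^ 3)" by simp
  \<comment> \<open>the exact third absolute moment is \<open>2 * \<sigma> ^ 3 * sqrt (2 / pi)\<close>\<close>
  have "sqrt (2 / pi) \<le> 1" using pi_gt3 by simp
  then have "2 * \<sigma> ^ 3 * sqrt (2 / pi) \<le> 2 * \<sigma> ^ 3 * 1"
    using \<sigma> by (intro mult_left_mono) auto
  also have "2 * \<sigma> ^ 3 * 1 = 2 * ((s' - s) * sqrt (s' - s))"
    unfolding \<sigma>(2)[symmetric] using \<sigma>(1) by (simp add: power2_eq_square power3_eq_cube)
  finally show "(LINT \<omega>|M. \<bar>Z \<omega>\<bar> ^ 3) \<le> 2 * ((s' - s) * sqrt (s' - s))" using 3 by simp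
qed

text \<open>
  Taylor's formula in the Brownian increment: the first-order term has mean zero and the second-order
  term has mean \<open>(s' - s) / 2\<close> times the expectation of \<open>f2 (X) \<eta>\<close>, by independence. The remainder is
  of order \<open>(s' - s) powr (3/2)\<close>, hence negligible after summation over a grid.
\<close>

lemma one_step_estimate:
  assumes f: "C3_bounded f f1 f2 f3 K" and s: "0 \<le> s" "s < s'"
    and X: "X \<in> borel_measurable (F s)" and \<eta>: "\<eta> \<in> borel_measurable (F s)"
    and \<eta>1: "AE \<omega> in M. \<bar>\<eta> \<omega>\<bar> \<le> 1"
  shows "\<bar>(LINT \<omega>|M. f (X \<omega> + (B s' \<omega> - B s \<omega>)) * \<eta> \<omega>) - (LINT \<omega>|M. f (X \<omega>) * \<eta> \<omega>)
    - (s' - s) * (LINT \<omega>|M. f2 (X \<omega>) * \<eta> \<omega> / 2)\<bar> \<le> K * ((s' - s) * sqrt (s' - s))"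
proof -
  interpret C3_bounded f f1 f2 f3 K by fact
  define Z where "Z = (\<lambda>\<omega>. B s' \<omega> - B s \<omega>)"
  have mom: "integrable M Z" "(LINT \<omega>|M. Z \<omega>) = 0"
    "integrable M (\<lambda>\<omega>. (Z \<omega>)\<^sup>2)" "(LINT \<omega>|M. (Z \<omega>)\<^sup>2) = s' - s"
    "integrable M (\<lambda>\<omega>. \<bar>Z \<omega>\<bar> ^ 3)"
    "(LINT \<omega>|M. \<bar>Z \<omega>\<bar> ^ 3) \<le> 2 * ((s' - s) * sqrt (s' - s))"
    unfolding Z_def by (rule increment_moments[OF s])+
  note Xm [measurable] = adapted_measurable[OF X] and \<eta>m [measurable] = adapted_measurable[OF \<eta>]
  have Zm [measurable]: "Z \<in> borel_measurable M"
    unfolding Z_def by (rule increment_measurable[OF s])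
  have bd: "integrable M (\<lambda>\<omega>. h (X \<omega>) * \<eta> \<omega>)"
    if "h \<in> borel_measurable borel" "\<And>x. \<bar>h x\<bar> \<le> K" for h
  proof (rule integrable_const_bound[where B=K])
    show "AE \<omega> in M. norm (h (X \<omega>) * \<eta> \<omega>) \<le> K"
      using \<eta>1
    proof eventually_elim
      case (elim \<omega>)
      have "\<bar>h (X \<omega>)\<bar> * \<bar>\<eta> \<omega>\<bar> \<le> K * 1"
        using elim that K_nonneg by (intro mult_mono) auto
      then show ?case by (simp add: abs_mult)
    qed
    show "(\<lambda>\<omega>. h (X \<omega>) * \<eta> \<omega>) \<in> borel_measurable M" using that(1) by measurable
  qed
  have i0: "integrable M (\<lambda>\<omega>. f (X \<omega>) * \<eta> \<omega>)" by (rule bd) (auto intro: f_bound)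
  have i1: "integrable M (\<lambda>\<omega>. f1 (X \<omega>) * \<eta> \<omega>)" by (rule bd) (auto intro: f_bound)
  have i2: "integrable M (\<lambda>\<omega>. f2 (X \<omega>) * \<eta> \<omega>)" by (rule bd) (auto intro: f_bound)
  have mF: "(\<lambda>\<omega>. f1 (X \<omega>) * \<eta> \<omega>) \<in> borel_measurable (F s)" "(\<lambda>\<omega>. f2 (X \<omega>) * \<eta> \<omega>) \<in> borel_measurable (F s)"
    using X \<eta> by measurable
  have iz: "integrable M (\<lambda>\<omega>. f (X \<omega> + Z \<omega>) * \<eta> \<omega>)"
  proof (rule integrable_const_bound[where B=K])
    show "AE \<omega> in M. norm (f (X \<omega> + Z \<omega>) * \<eta> \<omega>) \<le> K"
      using \<eta>1
    proof eventually_elim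
      case (elim \<omega>)
      have "\<bar>f (X \<omega> + Z \<omega>)\<bar> * \<bar>\<eta> \<omega>\<bar> \<le> K * 1"
        using elim K_nonneg f_bound(1) by (intro mult_mono) auto
      then show ?case by (simp add: abs_mult)
    qed
  qed measurable
  have e1: "integrable M (\<lambda>\<omega>. f1 (X \<omega>) * \<eta> \<omega> * Z \<omega>)" "(LINT \<omega>|M. f1 (X \<omega>) * \<eta> \<omega> * Z \<omega>) = 0"
    using expectation_mult_increment[OF s mF(1) i1, of "\<lambda>z. z", folded Z_def] mom(1,2)
    by (simp_all add: Z_def)
  have e2: "integrable M (\<lambda>\<omega>. f2 (X \<omega>) * \<eta> \<omega> * (Z \<omega>)\<^sup>2)"
    "(LINT \<omega>|M. f2 (X \<omega>) * \<eta> \<omega> * (Z \<omega>)\<^sup>2) = (LINT \<omega>|M. f2 (X \<omega>) * \<eta> \<omega>) * (s' - s)"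
    using expectation_mult_increment[OF s mF(2) i2, of "\<lambda>z. z\<^sup>2"] mom(3,4)
    by (simp_all add: Z_def)
  let ?R = "\<lambda>\<omega>. f (X \<omega> + Z \<omega>) * \<eta> \<omega> - f (X \<omega>) * \<eta> \<omega> - f1 (X \<omega>) * \<eta> \<omega> * Z \<omega>
    - f2 (X \<omega>) * \<eta> \<omega> * (Z \<omega>)\<^sup>2 / 2"
  have "(LINT \<omega>|M. f (X \<omega> + Z \<omega>) * \<eta> \<omega>) - (LINT \<omega>|M. f (X \<omega>) * \<eta> \<omega>)
      - (s' - s) * (LINT \<omega>|M. f2 (X \<omega>) * \<eta> \<omega> / 2) = (LINT \<omega>|M. ?R \<omega>)"
    using iz i0 e1 e2 by simp
  also have "\<bar>\<dots>\<bar> \<le> (LINT \<omega>|M. K * \<bar>Z \<omega>\<bar> ^ 3 / 2)"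
  proof -
    have "\<bar>LINT \<omega>|M. ?R \<omega>\<bar> \<le> (LINT \<omega>|M. \<bar>?R \<omega>\<bar>)" by (rule integral_abs_bound)
    also have "\<dots> \<le> (LINT \<omega>|M. K * \<bar>Z \<omega>\<bar> ^ 3 / 2)"
    proof (rule integral_mono_AE)
      show "AE \<omega> in M. \<bar>?R \<omega>\<bar> \<le> K * \<bar>Z \<omega>\<bar> ^ 3 / 2"
        using \<eta>1
      proof eventually_elim
        case (elim \<omega>)
        have "?R \<omega> = (f (X \<omega> + Z \<omega>) - f (X \<omega>) - f1 (X \<omega>) * Z \<omega> - f2 (X \<omega>) * (Z \<omega>)\<^sup>2 / 2) * \<eta> \<omega>"
          by (simp add: algebra_simps)
        then have "\<bar>?R \<omega>\<bar> \<le> (K * \<bar>Z \<omega>\<bar> ^ 3 / 2) * 1"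
          unfolding abs_mult using elim taylor[of "X \<omega>" "Z \<omega>"] K_nonneg
          by (simp only: abs_mult) (intro mult_mono, auto)
        then show ?case by simp
      qed
    qed (use iz i0 e1 e2 mom(5) in auto)
    finally show ?thesis .
  qed
  also have "\<dots> = K / 2 * (LINT \<omega>|M. \<bar>Z \<omega>\<bar> ^ 3)" by simp
  also have "\<dots> \<le> K / 2 * (2 * ((s' - s) * sqrt (s' - s)))"
    using mom(6) K_nonneg by (intro mult_left_mono) auto
  finally show ?thesis by (simp add: Z_def)
qed

text \<open>
  Dynkin's formula for \<open>f (X) exp (- D)\<close>, where \<open>X = B + C\<close> and \<open>C\<close>, \<open>D\<close> have the densities \<open>c\<close>, \<open>d\<close>.
  The pathwise generator integral is
  \<open>\<integral> (f2 (X) / 2 + f1 (X) c - f (X) d) exp (- D) du\<close>. It need not be measurable in \<open>\<omega>\<close>, since the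
  paths are regular only almost everywhere, and its integrand need not be bounded. The statement
  therefore compares it, up to an error \<open>Err\<close>, with the integral of a bounded process \<open>Y\<close> with
  continuous paths. The constant \<open>W\<close> provides the domination of the discretised finite-variation
  part.
\<close>

lemma dynkin_estimate:
  assumes f: "C3_bounded f f1 f2 f3 K" and t: "t > 0"
    and X: "\<And>s. s \<in> {0..t} \<Longrightarrow> X s \<in> borel_measurable (F s)"
    and D: "\<And>s. s \<in> {0..t} \<Longrightarrow> D s \<in> borel_measurable (F s)"
    and Y: "\<And>s. s \<in> {0..t} \<Longrightarrow> Y s \<in> borel_measurable M"
    and Yb: "\<And>s \<omega>. s \<in> {0..t} \<Longrightarrow> \<omega> \<in> space M \<Longrightarrow> \<bar>Y s \<omega>\<bar> \<le> L"
    and Err: "Err \<in> borel_measurable M" "\<And>\<omega>. 0 \<le> Err \<omega>" "AE \<omega> in M. Err \<omega> \<le> L'"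
    and Yc: "AE \<omega> in M. continuous_on {0..t} (\<lambda>u. Y u \<omega>)"
    and paths: "AE \<omega> in M. \<exists>c d.
      has_rate t (\<lambda>u. X u \<omega> - B u \<omega>) c \<and> has_rate t (\<lambda>u. D u \<omega>) d \<and> 0 \<le> D 0 \<omega> \<and>
      (\<forall>n>0. (\<Sum>k<n. exp (- D (t * real (Suc k) / real n) \<omega>) *
        ((X (t * real (Suc k) / real n) \<omega> - B (t * real (Suc k) / real n) \<omega>)
          - (X (t * real k / real n) \<omega> - B (t * real k / real n) \<omega>))) \<le> W) \<and>
      \<bar>integral {0..t} (\<lambda>u. f2 (X u \<omega>) * exp (- D u \<omega>) / 2)
        + (integral {0..t} (\<lambda>u. (f1 (X u \<omega>) * exp (- D u \<omega>)) * c u)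
          + integral {0..t} (\<lambda>u. (- f (X u \<omega>) * exp (- D u \<omega>)) * d u))
        - integral {0..t} (\<lambda>u. Y u \<omega>)\<bar> \<le> Err \<omega>"
  shows "\<bar>(LINT \<omega>|M. f (X t \<omega>) * exp (- D t \<omega>)) - (LINT \<omega>|M. f (X 0 \<omega>) * exp (- D 0 \<omega>))
    - integral {0..t} (\<lambda>u. LINT \<omega>|M. Y u \<omega>)\<bar> \<le> (LINT \<omega>|M. Err \<omega>)"
proof -
  interpret C3_bounded f f1 f2 f3 K by fact
  let ?g = "\<lambda>n k. t * real k / real n"
  note gb = grid_bounds[OF less_imp_le[OF t]]
  have g_in: "?g n k \<in> {0..t}" "?g n (Suc k) \<in> {0..t}" if "k < n" for n k
    using gb[OF that] by auto
  have Xm: "X s \<in> borel_measurable M" and Dm: "D s \<in> borel_measurable M" if "s \<in> {0..t}" for s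
    using that X D adapted_measurable by auto
  have Bm: "B s \<in> borel_measurable M" if "s \<in> {0..t}" for s
    using that adapted adapted_measurable by auto
  have DAE: "AE \<omega> in M. \<forall>s\<in>{0..t}. 0 \<le> D s \<omega>"
    using paths
  proof eventually_elim
    case (elim \<omega>)
    then obtain d where d: "has_rate t (\<lambda>u. D u \<omega>) d" "0 \<le> D 0 \<omega>" by blast
    show ?case
    proof
      fix s assume "s \<in> {0..t}"
      then show "0 \<le> D s \<omega>" using has_rate_mono[OF d(1), of 0 s] d(2) by auto
    qed
  qed
  have eD1: "AE \<omega> in M. \<bar>exp (- D s \<omega>)\<bar> \<le> 1" if "s \<in> {0..t}" for s
    using DAE by eventually_elim (use that in auto)

  define P where "P n k \<omega> = f (X (?g n k) \<omega> + (B (?g n (Suc k)) \<omega> - B (?g n k) \<omega>)) * exp (- D (?g n k) \<omega>)" for n k \<omega>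
  define E where "E s \<omega> = f (X s \<omega>) * exp (- D s \<omega>)" for s \<omega>
  define Q where "Q s \<omega> = f2 (X s \<omega>) * exp (- D s \<omega>) / 2" for s \<omega>
  have Pm: "P n k \<in> borel_measurable M" if "k < n" for n k
  proof -
    note [measurable] = Xm[OF g_in(1)[OF that]] Dm[OF g_in(1)[OF that]] Bm[OF g_in(1)[OF that]] Bm[OF g_in(2)[OF that]]
    show ?thesis unfolding P_def by measurable
  qed
  have Em: "E s \<in> borel_measurable M" and Qm: "Q s \<in> borel_measurable M" if "s \<in> {0..t}" for s
  proof -
    note [measurable] = Xm[OF that] Dm[OF that]
    show "E s \<in> borel_measurable M" unfolding E_def by measurable
    show "Q s \<in> borel_measurable M" unfolding Q_def by measurable
  qed
  have bound: "AE \<omega> in M. norm (h (Z \<omega>) * exp (- D s \<omega>)) \<le> K"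
    if "s \<in> {0..t}" "\<And>x. \<bar>h x\<bar> \<le> K" for h :: "real \<Rightarrow> real" and Z s
    using eD1[OF that(1)]
  proof eventually_elim
    case (elim \<omega>)
    have "\<bar>h (Z \<omega>)\<bar> * \<bar>exp (- D s \<omega>)\<bar> \<le> K * 1"
      by (rule mult_mono) (use elim that(2) K_nonneg in auto)
    then show ?case by (simp add: abs_mult)
  qed
  have Pi: "integrable M (P n k)" if "k < n" for n k
    by (rule integrable_const_bound[where B=K]) (use Pm[OF that] bound[OF g_in(1)[OF that] f_bound(1)] in \<open>simp_all add: P_def\<close>)
  have Ei: "integrable M (E s)" if "s \<in> {0..t}" for s
    by (rule integrable_const_bound[where B=K]) (use Em[OF that] bound[OF that f_bound(1)] in \<open>simp_all add: E_def\<close>)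
  have Qi: "integrable M (Q s)" if "s \<in> {0..t}" for s
  proof -
    note [measurable] = Xm[OF that] Dm[OF that]
    have "integrable M (\<lambda>\<omega>. f2 (X s \<omega>) * exp (- D s \<omega>))"
      by (rule integrable_const_bound[where B=K]) (use bound[OF that f_bound(3)] in simp_all)
    then show ?thesis unfolding Q_def by simp
  qed
  have Yi: "integrable M (Y s)" if "s \<in> {0..t}" for s
    by (rule integrable_const_bound[where B=L]) (use Y Yb that in auto)

  \<comment> \<open>the discretised generator integral minus the discretised integral of \<open>Y\<close>; its expectation is
    within \<open>K * t * sqrt (t / n)\<close> of \<open>a n\<close>, and pathwise it tends to a limit bounded by \<open>Err\<close>\<close>
  define T where "T n \<omega> = (\<Sum>k<n. E (?g n (Suc k)) \<omega> - P n k \<omega>)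
    + (\<Sum>k<n. Q (?g n k) \<omega> * (t / real n)) - (\<Sum>k<n. Y (?g n k) \<omega> * (t / real n))" for n \<omega>
  have Ti: "integrable M (T n)" for n
    unfolding T_def
    by (intro Bochner_Integration.integrable_diff Bochner_Integration.integrable_add
        Bochner_Integration.integrable_sum integrable_mult_left)
      (use Ei Pi Qi Yi g_in in auto)
  define a where "a n = (LINT \<omega>|M. E t \<omega>) - (LINT \<omega>|M. E 0 \<omega>)
    - (\<Sum>k<n. (LINT \<omega>|M. Y (?g n k) \<omega>) * (t / real n))" for n
  have lim_a: "a \<longlonglongrightarrow> (LINT \<omega>|M. E t \<omega>) - (LINT \<omega>|M. E 0 \<omega>) - integral {0..t} (\<lambda>u. LINT \<omega>|M. Y u \<omega>)"
    unfolding a_def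
    by (intro tendsto_diff tendsto_const riemann_sums_tendsto[OF t]
        expectation_continuous_on[OF prob_space_axioms Y Yb Yc])
  have ET: "\<bar>(LINT \<omega>|M. T n \<omega>) - a n\<bar> \<le> K * t * sqrt (t / real n)" if n: "n > 0" for n
  proof -
    have tele: "(LINT \<omega>|M. E t \<omega>) - (LINT \<omega>|M. E 0 \<omega>)
        = (\<Sum>k<n. (LINT \<omega>|M. E (?g n (Suc k)) \<omega>) - (LINT \<omega>|M. E (?g n k) \<omega>))"
      using sum_lessThan_telescope[of "\<lambda>k. LINT \<omega>|M. E (?g n k) \<omega>" n] n by simp
    have "(LINT \<omega>|M. T n \<omega>) = (\<Sum>k<n. (LINT \<omega>|M. E (?g n (Suc k)) \<omega>) - (LINT \<omega>|M. P n k \<omega>))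
      + (\<Sum>k<n. (LINT \<omega>|M. Q (?g n k) \<omega>) * (t / real n)) - (\<Sum>k<n. (LINT \<omega>|M. Y (?g n k) \<omega>) * (t / real n))"
      unfolding T_def
      using Ei Pi Qi Yi g_in
      by (subst Bochner_Integration.integral_diff Bochner_Integration.integral_add
        Bochner_Integration.integral_sum; (intro Bochner_Integration.integrable_diff Bochner_Integration.integrable_add
        Bochner_Integration.integrable_sum integrable_mult_left)?; auto)+
    then have "(LINT \<omega>|M. T n \<omega>) - a n = (\<Sum>k<n. (LINT \<omega>|M. E (?g n k) \<omega>) - (LINT \<omega>|M. P n k \<omega>)
       + (LINT \<omega>|M. Q (?g n k) \<omega>) * (t / real n))"
      unfolding a_def tele by (simp add: sum.distrib sum_subtractf)
    moreover have "\<bar>(LINT \<omega>|M. E (?g n k) \<omega>) - (LINT \<omega>|M. P n k \<omega>) + (LINT \<omega>|M. Q (?g n k) \<omega>) * (t / real n)\<bar>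
        \<le> K * (t / real n * sqrt (t / real n))" if k: "k < n" for k
    proof -
      have "?g n k < ?g n (Suc k)"
        using t n by (intro divide_strict_right_mono mult_strict_left_mono) auto
      from one_step_estimate[OF f gb(1)[OF k] this X[OF g_in(1)[OF k]], of "\<lambda>\<omega>. exp (- D (?g n k) \<omega>)"]
        D[OF g_in(1)[OF k]] eD1[OF g_in(1)[OF k]]
      have "\<bar>(LINT \<omega>|M. P n k \<omega>) - (LINT \<omega>|M. E (?g n k) \<omega>) - (t / real n) * (LINT \<omega>|M. Q (?g n k) \<omega>)\<bar>
        \<le> K * (t / real n * sqrt (t / real n))"
        unfolding grid_step P_def E_def Q_def by simp
      then show ?thesis by (simp add: abs_le_iff mult.commute algebra_simps)
    qed
    ultimately have "\<bar>(LINT \<omega>|M. T n \<omega>) - a n\<bar> \<le> (\<Sum>k<n. K * (t / real n * sqrt (t / real n)))"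
      by (simp only:) (intro order_trans[OF sum_abs sum_mono], auto)
    also have "\<dots> = K * t * sqrt (t / real n)" using n by simp
    finally show ?thesis .
  qed
  have lim_K: "(\<lambda>n. K * t * sqrt (t / real n)) \<longlonglongrightarrow> 0"
  proof -
    have "(\<lambda>n. K * t * sqrt (t / real n)) \<longlonglongrightarrow> K * t * sqrt 0"
      by (intro tendsto_intros lim_const_over_n)
    then show ?thesis by simp
  qed
  \<comment> \<open>The pathwise limit of \<open>T n\<close> may fail to be measurable, but the excess of its absolute value over
    \<open>Err\<close> has the limit \<open>0\<close>, to which dominated convergence applies.\<close>
  have lim_max: "(\<lambda>n. LINT \<omega>|M. max 0 (\<bar>T n \<omega>\<bar> - Err \<omega>)) \<longlonglongrightarrow> (LINT \<omega>|M. 0)"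
  proof (rule integral_dominated_convergence[where w="\<lambda>_. K * (W + 1) + K * t + L * t"])
    show "(\<lambda>\<omega>. max 0 (\<bar>T n \<omega>\<bar> - Err \<omega>)) \<in> borel_measurable M" for n
      using Ti[of n] Err(1) by (intro borel_measurable_max) auto
    show "AE \<omega> in M. (\<lambda>n. max 0 (\<bar>T n \<omega>\<bar> - Err \<omega>)) \<longlonglongrightarrow> 0"
      using paths Yc AE_space
    proof eventually_elim
      case (elim \<omega>)
      then obtain c d where C: "has_rate t (\<lambda>u. X u \<omega> - B u \<omega>) c" and Dr: "has_rate t (\<lambda>u. D u \<omega>) d"
        and D0: "0 \<le> D 0 \<omega>"
        and err: "\<bar>integral {0..t} (\<lambda>u. f2 (X u \<omega>) * exp (- D u \<omega>) / 2)
        + (integral {0..t} (\<lambda>u. (f1 (X u \<omega>) * exp (- D u \<omega>)) * c u)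
          + integral {0..t} (\<lambda>u. (- f (X u \<omega>) * exp (- D u \<omega>)) * d u))
        - integral {0..t} (\<lambda>u. Y u \<omega>)\<bar> \<le> Err \<omega>" by blast
      have b: "continuous_on {0..t} (\<lambda>u. B u \<omega>)"
        by (rule continuous_on_subset[OF continuous_paths]) (use elim in auto)
      have Dc: "continuous_on {0..t} (\<lambda>u. D u \<omega>)" by (rule has_rate_continuous[OF Dr])
      have "continuous_on {0..t} (\<lambda>u. B u \<omega> + (X u \<omega> - B u \<omega>))"
        by (intro continuous_on_add b has_rate_continuous[OF C])
      then have Xc: "continuous_on {0..t} (\<lambda>u. X u \<omega>)" by simp
      have 1: "(\<lambda>n. \<Sum>k<n. E (?g n (Suc k)) \<omega> - P n k \<omega>) \<longlonglongrightarrow>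
         integral {0..t} (\<lambda>u. (f1 (X u \<omega>) * exp (- D u \<omega>)) * c u)
          + integral {0..t} (\<lambda>u. (- f (X u \<omega>) * exp (- D u \<omega>)) * d u)"
        using fv_sums_tendsto[OF t b C Dr D0] by (simp add: E_def P_def algebra_simps)
      have 2: "(\<lambda>n. \<Sum>k<n. Q (?g n k) \<omega> * (t / real n)) \<longlonglongrightarrow> integral {0..t} (\<lambda>u. Q u \<omega>)"
        unfolding Q_def
        by (intro riemann_sums_tendsto[OF t] continuous_intros continuous_on_compose2[OF f_continuous(3)[of UNIV]] Xc Dc) auto
      have 3: "(\<lambda>n. \<Sum>k<n. Y (?g n k) \<omega> * (t / real n)) \<longlonglongrightarrow> integral {0..t} (\<lambda>u. Y u \<omega>)"
        by (intro riemann_sums_tendsto[OF t] elim)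
      have "(\<lambda>n. max 0 (\<bar>T n \<omega>\<bar> - Err \<omega>)) \<longlonglongrightarrow> max 0 (\<bar>integral {0..t} (\<lambda>u. (f1 (X u \<omega>) * exp (- D u \<omega>)) * c u)
          + integral {0..t} (\<lambda>u. (- f (X u \<omega>) * exp (- D u \<omega>)) * d u) + integral {0..t} (\<lambda>u. Q u \<omega>)
          - integral {0..t} (\<lambda>u. Y u \<omega>)\<bar> - Err \<omega>)"
        unfolding T_def by (intro tendsto_max tendsto_const tendsto_diff tendsto_rabs tendsto_add 1 2 3)
      also have "max 0 (\<bar>integral {0..t} (\<lambda>u. (f1 (X u \<omega>) * exp (- D u \<omega>)) * c u)
          + integral {0..t} (\<lambda>u. (- f (X u \<omega>) * exp (- D u \<omega>)) * d u) + integral {0..t} (\<lambda>u. Q u \<omega>)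
          - integral {0..t} (\<lambda>u. Y u \<omega>)\<bar> - Err \<omega>) = 0"
        using err unfolding Q_def by linarith
      finally show ?case .
    qed
    show "AE \<omega> in M. norm (max 0 (\<bar>T n \<omega>\<bar> - Err \<omega>)) \<le> K * (W + 1) + K * t + L * t" for n
      using paths DAE AE_space
    proof eventually_elim
      case (elim \<omega>)
      from elim(1) obtain c d where C: "has_rate t (\<lambda>u. X u \<omega> - B u \<omega>) c" and Dr: "has_rate t (\<lambda>u. D u \<omega>) d"
        and D0: "0 \<le> D 0 \<omega>"
        and W: "\<forall>n>0. (\<Sum>k<n. exp (- D (t * real (Suc k) / real n) \<omega>) *
        ((X (t * real (Suc k) / real n) \<omega> - B (t * real (Suc k) / real n) \<omega>)
          - (X (t * real k / real n) \<omega> - B (t * real k / real n) \<omega>))) \<le> W" by blast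
      have "0 \<le> (\<Sum>k<1::nat. exp (- D (t * real (Suc k) / real 1) \<omega>) *
        ((X (t * real (Suc k) / real 1) \<omega> - B (t * real (Suc k) / real 1) \<omega>)
          - (X (t * real k / real 1) \<omega> - B (t * real k / real 1) \<omega>)))"
        using has_rate_mono[OF C, of 0 t] t by simp
      also have "\<dots> \<le> W" using W[rule_format, of 1] by simp
      finally have W0: "0 \<le> W" .
      have L0: "0 \<le> L" using Yb[of 0 \<omega>] t elim(3) by (simp add: order_trans[OF abs_ge_zero])
      have pos: "0 \<le> K * (W + 1) + K * t + L * t"
        using W0 L0 K_nonneg t by simp
      show ?case
      proof (cases "n = 0")
        case True
        then show ?thesis using pos Err(2)[of \<omega>] by (simp add: T_def)
      next
        case False
        have 1: "\<bar>\<Sum>k<n. E (?g n (Suc k)) \<omega> - P n k \<omega>\<bar> \<le> K * (W + 1)"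
          using fv_sums_bounded[OF t C Dr D0 W[rule_format], of n "\<lambda>u. B u \<omega>"] False
          by (simp add: E_def P_def algebra_simps)
        have h: "0 \<le> t / real n" using t by simp
        have 2: "\<bar>\<Sum>k<n. Q (?g n k) \<omega> * (t / real n)\<bar> \<le> K * t"
        proof -
          have "\<bar>\<Sum>k<n. Q (?g n k) \<omega> * (t / real n)\<bar> \<le> (\<Sum>k<n. K * (t / real n))"
          proof (rule order_trans[OF sum_abs sum_mono])
            fix k assume "k \<in> {..<n}"
            then have k: "k < n" by simp
            have "\<bar>f2 (X (?g n k) \<omega>)\<bar> * exp (- D (?g n k) \<omega>) \<le> K * 1"
              by (rule mult_mono) (use elim(2) g_in(1)[OF k] f_bound(3) K_nonneg in auto)
            then have "\<bar>Q (?g n k) \<omega>\<bar> \<le> K"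
              using K_nonneg unfolding Q_def by (simp add: abs_mult)
            then show "\<bar>Q (?g n k) \<omega> * (t / real n)\<bar> \<le> K * (t / real n)"
              unfolding abs_mult abs_of_nonneg[OF h] by (rule mult_right_mono[OF _ h])
          qed
          then show ?thesis using False by simp
        qed
        have 3: "\<bar>\<Sum>k<n. Y (?g n k) \<omega> * (t / real n)\<bar> \<le> L * t"
        proof -
          have "\<bar>\<Sum>k<n. Y (?g n k) \<omega> * (t / real n)\<bar> \<le> (\<Sum>k<n. L * (t / real n))"
          proof (rule order_trans[OF sum_abs sum_mono])
            fix k assume "k \<in> {..<n}"
            then have k: "k < n" by simp
            show "\<bar>Y (?g n k) \<omega> * (t / real n)\<bar> \<le> L * (t / real n)"
              unfolding abs_mult abs_of_nonneg[OF h] by (rule mult_right_mono[OF Yb[OF g_in(1)[OF k] elim(3)] h])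
          qed
          then show ?thesis using False by simp
        qed
        have "\<bar>T n \<omega>\<bar> \<le> K * (W + 1) + K * t + L * t"
          using 1 2 3 unfolding T_def by linarith
        then show ?thesis using Err(2)[of \<omega>] pos by simp
      qed
    qed
  qed simp_all
  have Erri: "integrable M Err"
    by (rule integrable_const_bound[where B=L']) (use Err in auto)
  have step: "\<bar>a n\<bar> \<le> (LINT \<omega>|M. Err \<omega>) + (LINT \<omega>|M. max 0 (\<bar>T n \<omega>\<bar> - Err \<omega>)) + K * t * sqrt (t / real n)"
    if "n > 0" for n
  proof -
    have i: "integrable M (\<lambda>\<omega>. max 0 (\<bar>T n \<omega>\<bar> - Err \<omega>))"
      using Ti[of n] Erri by (intro integrable_max) auto
    have "\<bar>LINT \<omega>|M. T n \<omega>\<bar> \<le> (LINT \<omega>|M. \<bar>T n \<omega>\<bar>)" by (rule integral_abs_bound)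
    also have "\<dots> \<le> (LINT \<omega>|M. Err \<omega> + max 0 (\<bar>T n \<omega>\<bar> - Err \<omega>))"
      by (rule integral_mono) (use Ti[of n] Erri i in auto)
    also have "\<dots> = (LINT \<omega>|M. Err \<omega>) + (LINT \<omega>|M. max 0 (\<bar>T n \<omega>\<bar> - Err \<omega>))"
      by (rule Bochner_Integration.integral_add[OF Erri i])
    finally show ?thesis using ET[OF that] by linarith
  qed
  have "\<bar>(LINT \<omega>|M. E t \<omega>) - (LINT \<omega>|M. E 0 \<omega>) - integral {0..t} (\<lambda>u. LINT \<omega>|M. Y u \<omega>)\<bar>
      \<le> (LINT \<omega>|M. Err \<omega>) + (LINT \<omega>|M. 0) + 0"
  proof (rule tendsto_le[OF _ _ tendsto_rabs[OF lim_a]])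
    show "(\<lambda>n. (LINT \<omega>|M. Err \<omega>) + (LINT \<omega>|M. max 0 (\<bar>T n \<omega>\<bar> - Err \<omega>)) + K * t * sqrt (t / real n))
      \<longlonglongrightarrow> (LINT \<omega>|M. Err \<omega>) + (LINT \<omega>|M. 0) + 0"
      by (intro tendsto_add tendsto_const lim_max lim_K)
    show "\<forall>\<^sub>F n in sequentially. \<bar>a n\<bar> \<le> (LINT \<omega>|M. Err \<omega>) + (LINT \<omega>|M. max 0 (\<bar>T n \<omega>\<bar> - Err \<omega>)) + K * t * sqrt (t / real n)"
      using eventually_gt_at_top[of 0] by eventually_elim (rule step)
  qed simp
  then show ?thesis unfolding E_def by simp
qed

end

section \<open>The exponential test functions and their common generator\<close>

lemma power_le_fact_exp:
  fixes y :: real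
  assumes "0 \<le> y"
  shows "y ^ k * exp (- y) \<le> fact k"
proof -
  have "(\<Sum>n\<in>{k}. y ^ n /\<^sub>R fact n) \<le> (\<Sum>n. y ^ n /\<^sub>R fact n)"
    by (rule sum_le_suminf) (use assms summable_exp_generic[of y] in \<open>auto simp: scaleR_conv_of_real\<close>)
  then have "y ^ k / fact k \<le> exp y" by (simp add: exp_def divide_inverse mult.commute)
  then show ?thesis by (simp add: exp_minus field_simps)
qed

text \<open>
  The source of all uniform bounds: every derivative of the test functions, and their generator, is
  a polynomial in \<open>y\<close> of degree at most three times \<open>exp (- y)\<close>, with \<open>y = p cosh r\<close> or
  \<open>y = q exp b\<close>.
\<close>

lemma poly_exp_bounds:
  fixes y :: real
  assumes "0 \<le> y"
  shows "y * exp (- y) \<le> 1" "y\<^sup>2 * exp (- y) \<le> 2" "y ^ 3 * exp (- y) \<le> 6" "exp (- y) \<le> 1"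
  using power_le_fact_exp[OF assms, of 1] power_le_fact_exp[OF assms, of 2]
    power_le_fact_exp[OF assms, of 3] assms by (simp_all add: fact_numeral)

lemma cubic_exp_bound:
  fixes a b c y :: real
  assumes "0 \<le> y" "\<bar>a\<bar> \<le> y ^ 3" "\<bar>b\<bar> \<le> y\<^sup>2" "\<bar>c\<bar> \<le> y"
  shows "\<bar>(a + 3 * b + c) * exp (- y)\<bar> \<le> 13"
proof -
  have "\<bar>a + 3 * b + c\<bar> \<le> y ^ 3 + 3 * y\<^sup>2 + y" using assms by linarith
  then have "\<bar>a + 3 * b + c\<bar> * exp (- y) \<le> (y ^ 3 + 3 * y\<^sup>2 + y) * exp (- y)"
    by (rule mult_right_mono) simp
  also have "\<dots> = y ^ 3 * exp (- y) + 3 * (y\<^sup>2 * exp (- y)) + y * exp (- y)"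
    by (simp add: algebra_simps)
  \<comment> \<open>\<open>13 = 6 + 3 * 2 + 1\<close>\<close>
  also have "\<dots> \<le> 13" using poly_exp_bounds[OF assms(1)] by linarith
  finally show ?thesis by (simp add: abs_mult)
qed

lemma abs_sinh_le_cosh: "\<bar>sinh x\<bar> \<le> cosh (x :: real)"
proof -
  have "(sinh x)\<^sup>2 \<le> (cosh x)\<^sup>2" by (simp add: cosh_square_eq)
  then have "\<bar>sinh x\<bar> \<le> \<bar>cosh x\<bar>" by (simp only: abs_le_square_iff)
  then show ?thesis by simp
qed

lemma C3_bounded_exp_cosh:
  assumes p: "p \<ge> (0::real)"
  shows "C3_bounded (\<lambda>r. exp (- p * cosh r)) (\<lambda>r. - p * sinh r * exp (- p * cosh r))
    (\<lambda>r. ((p * sinh r)\<^sup>2 - p * cosh r) * exp (- p * cosh r))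
    (\<lambda>r. (- ((p * sinh r) ^ 3) + 3 * (p * sinh r * (p * cosh r)) - p * sinh r) * exp (- p * cosh r)) 13"
proof
  fix r :: real
  show "((\<lambda>r. exp (- p * cosh r)) has_real_derivative - p * sinh r * exp (- p * cosh r)) (at r)"
    "((\<lambda>r. - p * sinh r * exp (- p * cosh r)) has_real_derivative
      ((p * sinh r)\<^sup>2 - p * cosh r) * exp (- p * cosh r)) (at r)"
    "((\<lambda>r. ((p * sinh r)\<^sup>2 - p * cosh r) * exp (- p * cosh r)) has_real_derivative
      (- ((p * sinh r) ^ 3) + 3 * (p * sinh r * (p * cosh r)) - p * sinh r) * exp (- p * cosh r)) (at r)"
    by (auto intro!: derivative_eq_intros simp: algebra_simps power2_eq_square power3_eq_cube)
  define y where "y = p * cosh r"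
  have y: "0 \<le> y" using p by (simp add: y_def)
  have s: "\<bar>p * sinh r\<bar> \<le> y"
    unfolding y_def abs_mult using p abs_sinh_le_cosh[of r] by (simp add: mult_left_mono)
  have s2: "(p * sinh r)\<^sup>2 \<le> y\<^sup>2" using s by (rule power2_le_iff_abs_le[THEN iffD2, OF y])
  have s3: "\<bar>p * sinh r\<bar> ^ 3 \<le> y ^ 3" using s by (rule power_mono) simp
  have s11: "\<bar>p * sinh r\<bar> * y \<le> y\<^sup>2"
    unfolding power2_eq_square using s y by (intro mult_mono) auto
  note e = poly_exp_bounds[OF y]
  have ey: "exp (- p * cosh r) = exp (- y)" by (simp add: y_def)
  show "\<bar>exp (- p * cosh r)\<bar> \<le> 13" unfolding ey abs_exp_cancel using e(4) by linarith
  show "\<bar>- p * sinh r * exp (- p * cosh r)\<bar> \<le> 13"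
    unfolding ey using cubic_exp_bound[OF y, of 0 0 "- p * sinh r"] s y by (simp add: abs_mult)
  have "0 \<le> (p * sinh r)\<^sup>2" by simp
  then have "\<bar>(p * sinh r)\<^sup>2 / 3\<bar> \<le> y\<^sup>2" using s2 by linarith
  then have "\<bar>(0 + 3 * ((p * sinh r)\<^sup>2 / 3) + - y) * exp (- y)\<bar> \<le> 13"
    by (intro cubic_exp_bound[OF y]) (use y in auto)
  then show "\<bar>((p * sinh r)\<^sup>2 - p * cosh r) * exp (- p * cosh r)\<bar> \<le> 13"
    unfolding ey y_def[symmetric] by simp
  have "\<bar>(- ((p * sinh r) ^ 3) + 3 * (p * sinh r * y) + - (p * sinh r)) * exp (- y)\<bar> \<le> 13"
    by (rule cubic_exp_bound[OF y]) (use y s s3 s11 in \<open>auto simp: abs_mult power_abs\<close>)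
  then show "\<bar>(- ((p * sinh r) ^ 3) + 3 * (p * sinh r * (p * cosh r)) - p * sinh r) * exp (- p * cosh r)\<bar> \<le> 13"
    unfolding ey y_def[symmetric] by simp
qed

lemma C3_bounded_exp_exp:
  assumes q: "q \<ge> (0::real)"
  shows "C3_bounded (\<lambda>b. exp (- q * exp b)) (\<lambda>b. - (q * exp b) * exp (- q * exp b))
    (\<lambda>b. ((q * exp b)\<^sup>2 - q * exp b) * exp (- q * exp b))
    (\<lambda>b. (- ((q * exp b) ^ 3) + 3 * (q * exp b)\<^sup>2 - q * exp b) * exp (- q * exp b)) 13"
proof
  fix b :: real
  show "((\<lambda>b. exp (- q * exp b)) has_real_derivative - (q * exp b) * exp (- q * exp b)) (at b)"
    "((\<lambda>b. - (q * exp b) * exp (- q * exp b)) has_real_derivative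
      ((q * exp b)\<^sup>2 - q * exp b) * exp (- q * exp b)) (at b)"
    "((\<lambda>b. ((q * exp b)\<^sup>2 - q * exp b) * exp (- q * exp b)) has_real_derivative
      (- ((q * exp b) ^ 3) + 3 * (q * exp b)\<^sup>2 - q * exp b) * exp (- q * exp b)) (at b)"
    by (auto intro!: derivative_eq_intros simp: algebra_simps power2_eq_square power3_eq_cube)
  define y where "y = q * exp b"
  have y: "0 \<le> y" using q by (simp add: y_def)
  note e = poly_exp_bounds[OF y]
  have ey: "exp (- q * exp b) = exp (- y)" by (simp add: y_def)
  show "\<bar>exp (- q * exp b)\<bar> \<le> 13" unfolding ey abs_exp_cancel using e(4) by linarith
  show "\<bar>- (q * exp b) * exp (- q * exp b)\<bar> \<le> 13"
    unfolding ey y_def[symmetric] using e y by (simp add: abs_mult)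
  have "\<bar>(0 + 3 * (y\<^sup>2 / 3) + - y) * exp (- y)\<bar> \<le> 13"
    by (rule cubic_exp_bound[OF y]) (use y in auto)
  then show "\<bar>((q * exp b)\<^sup>2 - q * exp b) * exp (- q * exp b)\<bar> \<le> 13"
    unfolding ey y_def[symmetric] by simp
  have "\<bar>(- (y ^ 3) + 3 * y\<^sup>2 + - y) * exp (- y)\<bar> \<le> 13"
    by (rule cubic_exp_bound[OF y]) (use y in \<open>auto simp: abs_mult power_abs\<close>)
  then show "\<bar>(- ((q * exp b) ^ 3) + 3 * (q * exp b)\<^sup>2 - q * exp b) * exp (- q * exp b)\<bar> \<le> 13"
    unfolding ey y_def[symmetric] by simp
qed

text \<open>
  \<open>f'' / 2 + \<mu> coth r f'\<close> for \<open>f r = exp (- p cosh r)\<close>. For \<open>p = \<lambda> v\<close> it is also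
  \<open>v\<^sup>2 g'' / 2 + (\<mu> + 1/2) v g' - \<lambda>\<^sup>2 v\<^sup>2 g / 2\<close> for \<open>g v = exp (- \<lambda> v cosh r)\<close>.
\<close>

definition cosh_generator :: "real \<Rightarrow> real \<Rightarrow> real \<Rightarrow> real" where
  "cosh_generator \<mu> p r = ((p * sinh r)\<^sup>2 / 2 - (\<mu> + 1 / 2) * (p * cosh r)) * exp (- p * cosh r)"

lemma cosh_generator_bound:
  assumes "0 \<le> \<mu>" "0 \<le> p"
  shows "\<bar>cosh_generator \<mu> p r\<bar> \<le> \<mu> + 3 / 2"
proof -
  define y where "y = p * cosh r"
  have y: "0 \<le> y" using assms by (simp add: y_def)
  have "\<bar>p * sinh r\<bar> \<le> y"
    unfolding y_def abs_mult using assms abs_sinh_le_cosh[of r] by (simp add: mult_left_mono)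
  then have s2: "(p * sinh r)\<^sup>2 \<le> y\<^sup>2" by (rule power2_le_iff_abs_le[THEN iffD2, OF y])
  have "\<bar>(p * sinh r)\<^sup>2 / 2 - (\<mu> + 1 / 2) * y\<bar> \<le> y\<^sup>2 / 2 + (\<mu> + 1 / 2) * y"
    using s2 y assms by (simp add: abs_le_iff add_increasing)
  then have "\<bar>(p * sinh r)\<^sup>2 / 2 - (\<mu> + 1 / 2) * y\<bar> * exp (- y) \<le> (y\<^sup>2 / 2 + (\<mu> + 1 / 2) * y) * exp (- y)"
    by (rule mult_right_mono) simp
  also have "\<dots> = y\<^sup>2 * exp (- y) / 2 + (\<mu> + 1 / 2) * (y * exp (- y))" by (simp add: algebra_simps)
  also have "\<dots> \<le> 2 / 2 + (\<mu> + 1 / 2) * 1"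
    using poly_exp_bounds[OF y] assms by (intro add_mono divide_right_mono mult_left_mono) auto
  finally show ?thesis by (simp add: cosh_generator_def y_def abs_mult)
qed

lemma cosh_generator_measurable [measurable]:
  assumes [measurable]: "p \<in> borel_measurable M" "r \<in> borel_measurable M"
  shows "(\<lambda>\<omega>. cosh_generator \<mu> (p \<omega>) (r \<omega>)) \<in> borel_measurable M"
proof -
  have [measurable]: "(sinh :: real \<Rightarrow> real) \<in> borel_measurable borel" "(cosh :: real \<Rightarrow> real) \<in> borel_measurable borel"
    by (auto intro!: borel_measurable_continuous_onI continuous_intros)
  show ?thesis unfolding cosh_generator_def by measurable
qed

lemma cosh_generator_continuous [continuous_intros]:
  assumes "continuous_on S p" "continuous_on S r"
  shows "continuous_on S (\<lambda>u. cosh_generator \<mu> (p u) (r u))"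
  unfolding cosh_generator_def by (intro continuous_intros assms) simp

section \<open>The two evolution equations\<close>

text \<open>
  Here \<open>D\<close> is \<open>e\<close> times the finite-variation part. Without the weight and the killing, the pathwise
  generator integral would be that of \<open>cosh_generator\<close>, because \<open>c sinh X = \<mu> cosh X\<close> off a null set.
  The weight changes it by at most \<open>1 - exp (- D t)\<close> times the bound of the generator times \<open>t\<close>, and
  the killing term is at most \<open>\<integral> exp (- D) dD \<le> 1 - exp (- D t)\<close>. The bound tends to zero with
  \<open>e\<close>, pathwise and boundedly.
\<close>

lemma cosh_path_error:
  assumes t: "t > 0" and X: "continuous_on {0..t} X" and C: "has_rate t C c"
    and N: "negligible N" "\<And>u. u \<in> {0..t} - N \<Longrightarrow> c u * sinh (X u) = \<mu> * cosh (X u)"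
    and e: "e > 0" and p: "p > 0" and \<mu>: "\<mu> \<ge> 0"
  defines "D \<equiv> \<lambda>u. e * (C u - C 0)"
  shows "\<bar>integral {0..t} (\<lambda>u. ((p * sinh (X u))\<^sup>2 - p * cosh (X u)) * exp (- p * cosh (X u)) * exp (- D u) / 2)
     + (integral {0..t} (\<lambda>u. - p * sinh (X u) * exp (- p * cosh (X u)) * exp (- D u) * c u)
      + integral {0..t} (\<lambda>u. - exp (- p * cosh (X u)) * exp (- D u) * (e * c u)))
     - integral {0..t} (\<lambda>u. cosh_generator \<mu> p (X u))\<bar> \<le> ((\<mu> + 3 / 2) * t + 1) * (1 - exp (- D t))"
proof -
  have D: "has_rate t D (\<lambda>u. e * c u)"
  proof (rule has_rateI[where a=0])
    show "(\<lambda>u. e * c u) integrable_on {0..t}"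
      using has_rateD(1)[OF C] by (rule integrable_on_mult_right)
    show "0 \<le> e * c u" if "u \<in> {0..t}" for u using has_rateD(2)[OF C that] e by simp
    show "D s = 0 + integral {0..s} (\<lambda>u. e * c u)" if "s \<in> {0..t}" for s
      using has_rateD(3)[OF C, of 0 s] that by (simp add: D_def)
  qed
  have Dc: "continuous_on {0..t} D" by (rule has_rate_continuous[OF D])
  have Dm: "0 \<le> D u" "D u \<le> D t" if "u \<in> {0..t}" for u
    using has_rate_mono[OF D, of 0 u] has_rate_mono[OF D, of u t] that by (auto simp: D_def)
  let ?f2 = "\<lambda>u. ((p * sinh (X u))\<^sup>2 - p * cosh (X u)) * exp (- p * cosh (X u)) * exp (- D u) / 2"
  let ?f1 = "\<lambda>u. - p * sinh (X u) * exp (- p * cosh (X u)) * exp (- D u) * c u"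
  let ?m = "\<lambda>u. - \<mu> * (p * cosh (X u)) * exp (- p * cosh (X u)) * exp (- D u)"
  let ?G = "\<lambda>u. cosh_generator \<mu> p (X u)"
  have Gc: "continuous_on {0..t} ?G" by (intro continuous_intros X)
  have f2i: "?f2 integrable_on {0..t}"
    by (intro integrable_continuous_real continuous_intros X Dc) simp
  have mi: "?m integrable_on {0..t}"
    by (intro integrable_continuous_real continuous_intros X Dc)
  have Gi: "?G integrable_on {0..t}" by (rule integrable_continuous_real[OF Gc])
  have f1m: "integral {0..t} ?f1 = integral {0..t} ?m"
  proof (rule integral_spike[OF N(1)])
    fix u assume u: "u \<in> {0..t} - N"
    have "?f1 u = - p * exp (- p * cosh (X u)) * exp (- D u) * (c u * sinh (X u))" by simp
    also have "\<dots> = ?m u" unfolding N(2)[OF u] by simp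
    finally show "?m u = ?f1 u" ..
  qed
  have "integral {0..t} ?f2 + integral {0..t} ?m - integral {0..t} ?G = integral {0..t} (\<lambda>u. ?f2 u + ?m u - ?G u)"
    unfolding Henstock_Kurzweil_Integration.integral_diff[OF integrable_add[OF f2i mi] Gi]
      Henstock_Kurzweil_Integration.integral_add[OF f2i mi] ..
  also have "(\<lambda>u. ?f2 u + ?m u - ?G u) = (\<lambda>u. - ?G u * (1 - exp (- D u)))"
    by (simp add: cosh_generator_def fun_eq_iff field_simps)
  finally have diff: "integral {0..t} ?f2 + integral {0..t} ?m - integral {0..t} ?G
    = integral {0..t} (\<lambda>u. - ?G u * (1 - exp (- D u)))" .
  have "norm (integral {0..t} (\<lambda>u. - ?G u * (1 - exp (- D u)))) \<le> (\<mu> + 3 / 2) * (1 - exp (- D t)) * (t - 0)"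
  proof (rule integral_bound)
    show "continuous_on {0..t} (\<lambda>u. - ?G u * (1 - exp (- D u)))" by (intro continuous_intros X Dc)
    fix u assume u: "u \<in> {0..t}"
    have "\<bar>?G u\<bar> * \<bar>1 - exp (- D u)\<bar> \<le> (\<mu> + 3 / 2) * (1 - exp (- D t))"
      using Dm[OF u] \<mu> p by (intro mult_mono cosh_generator_bound) auto
    then show "norm (- ?G u * (1 - exp (- D u))) \<le> (\<mu> + 3 / 2) * (1 - exp (- D t))"
      by (simp add: abs_mult)
  qed (use t in simp)
  then have 1: "\<bar>integral {0..t} ?f2 + integral {0..t} ?m - integral {0..t} ?G\<bar> \<le> (\<mu> + 3 / 2) * (1 - exp (- D t)) * t"
    unfolding diff by simp
  have 2: "\<bar>integral {0..t} (\<lambda>u. - exp (- p * cosh (X u)) * exp (- D u) * (e * c u))\<bar> \<le> 1 - exp (- D t)"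
  proof -
    have dn: "(\<lambda>u. exp (- D u) * (e * c u)) integrable_on {0..t}"
      by (rule continuous_times_integrable[OF _ has_rateD(1,2)[OF D]]) (intro continuous_intros Dc)
    have "norm (integral {0..t} (\<lambda>u. - exp (- p * cosh (X u)) * exp (- D u) * (e * c u)))
      \<le> integral {0..t} (\<lambda>u. exp (- D u) * (e * c u))"
    proof (rule integral_norm_bound_integral[OF _ dn])
      show "(\<lambda>u. - exp (- p * cosh (X u)) * exp (- D u) * (e * c u)) integrable_on {0..t}"
        by (rule continuous_times_integrable[OF _ has_rateD(1,2)[OF D]]) (intro continuous_intros Dc X)
      fix u assume u: "u \<in> {0..t}"
      have "exp (- p * cosh (X u)) * (exp (- D u) * (e * c u)) \<le> 1 * (exp (- D u) * (e * c u))"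
        using has_rateD(2)[OF D u] p by (intro mult_right_mono) auto
      then show "norm (- exp (- p * cosh (X u)) * exp (- D u) * (e * c u)) \<le> exp (- D u) * (e * c u)"
        using has_rateD(2)[OF C u] e by (simp add: abs_mult)
    qed
    also have "\<dots> \<le> exp (- D 0) - exp (- D t)" by (rule exp_weight_integral[OF t D])
    finally show ?thesis by (simp add: D_def)
  qed
  have "((\<mu> + 3 / 2) * t + 1) * (1 - exp (- D t)) = (\<mu> + 3 / 2) * (1 - exp (- D t)) * t + (1 - exp (- D t))"
    by (simp only: algebra_simps)
  then show ?thesis unfolding f1m using 1 2 by linarith
qed

context brownian_motion
begin

lemma has_rate_paths_continuous:
  assumes "AE \<omega> in M. \<exists>c. has_rate t (\<lambda>u. X u \<omega> - B u \<omega>) c"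
  shows "AE \<omega> in M. continuous_on {0..t} (\<lambda>u. X u \<omega>)"
  using assms AE_space
proof eventually_elim
  case (elim \<omega>)
  then obtain c where C: "has_rate t (\<lambda>u. X u \<omega> - B u \<omega>) c" by blast
  have "continuous_on {0..t} (\<lambda>u. B u \<omega> + (X u \<omega> - B u \<omega>))"
    by (intro continuous_on_add has_rate_continuous[OF C] continuous_on_subset[OF continuous_paths])
      (use elim in auto)
  then show ?case by simp
qed

text \<open>
  The forward equation for \<open>exp (- p cosh X)\<close>. The drift is only required to satisfy
  \<open>c sinh X = \<mu> cosh X\<close> for almost every time, which is the equation of the hyperbolic Bessel process
  away from its zeros and also covers \<open>X = x + B\<close>, with \<open>c = 0\<close> and \<open>\<mu> = 0\<close>.
\<close>

lemma expectation_exp_cosh: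
  assumes t: "t > 0" and p: "p > 0" and \<mu>: "\<mu> \<ge> 0"
    and X: "\<And>s. s \<in> {0..t} \<Longrightarrow> X s \<in> borel_measurable (F s)"
    and paths: "AE \<omega> in M. X 0 \<omega> = x \<and> (\<exists>c N. has_rate t (\<lambda>u. X u \<omega> - B u \<omega>) c \<and> negligible N \<and>
      (\<forall>u\<in>{0..t} - N. c u * sinh (X u \<omega>) = \<mu> * cosh (X u \<omega>)))"
  shows "(LINT \<omega>|M. exp (- p * cosh (X t \<omega>))) - exp (- p * cosh x)
    = integral {0..t} (\<lambda>u. LINT \<omega>|M. cosh_generator \<mu> p (X u \<omega>))"
proof -
  define C where "C s \<omega> = X s \<omega> - B s \<omega> - x" for s \<omega>
  \<comment> \<open>the weight that bounds the discretised drift by \<open>n + 1\<close>; it tends to \<open>1\<close> with growing \<open>n\<close>\<close>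
  define D where "D n s \<omega> = (1 / real (Suc n)) * C s \<omega>" for n s \<omega>
  define L where "L = (\<mu> + 3 / 2) * t + 1"
  define Err where "Err n \<omega> = L * max 0 (1 - exp (- D n t \<omega>))" for n \<omega>
  have L: "L \<ge> 0" using \<mu> t by (simp add: L_def)
  have CF: "C s \<in> borel_measurable (F s)" if "s \<in> {0..t}" for s
  proof -
    have [measurable]: "X s \<in> borel_measurable (F s)" "B s \<in> borel_measurable (F s)"
      using X adapted that by auto
    show ?thesis unfolding C_def by measurable
  qed
  have [measurable]: "C t \<in> borel_measurable M" "X t \<in> borel_measurable M" "X 0 \<in> borel_measurable M"
    "C 0 \<in> borel_measurable M"
    using CF[of t] CF[of 0] X[of t] X[of 0] t by (auto intro: adapted_measurable)
  have Xc: "AE \<omega> in M. continuous_on {0..t} (\<lambda>u. X u \<omega>)"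
    by (rule has_rate_paths_continuous) (use paths in \<open>eventually_elim, blast\<close>)
  have C0: "AE \<omega> in M. C 0 \<omega> = 0 \<and> 0 \<le> C t \<omega> \<and> X 0 \<omega> = x"
    using paths starts_at_zero
  proof eventually_elim
    case (elim \<omega>)
    then obtain c where C: "has_rate t (\<lambda>u. X u \<omega> - B u \<omega>) c" by blast
    from has_rate_mono[OF C, of 0 t] t elim show ?case by (auto simp: C_def)
  qed
  have est: "\<bar>(LINT \<omega>|M. exp (- p * cosh (X t \<omega>)) * exp (- D n t \<omega>))
      - (LINT \<omega>|M. exp (- p * cosh (X 0 \<omega>)) * exp (- D n 0 \<omega>))
    - integral {0..t} (\<lambda>u. LINT \<omega>|M. cosh_generator \<mu> p (X u \<omega>))\<bar> \<le> (LINT \<omega>|M. Err n \<omega>)" for n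
  proof (rule dynkin_estimate[OF C3_bounded_exp_cosh[OF less_imp_le[OF p]] t X,
        where L="\<mu> + 3 / 2" and L'=L and W="real (Suc n)"])
    show "D n s \<in> borel_measurable (F s)" if "s \<in> {0..t}" for s
      unfolding D_def using CF[OF that] by measurable
    show "(\<lambda>\<omega>. cosh_generator \<mu> p (X s \<omega>)) \<in> borel_measurable M" if "s \<in> {0..t}" for s
      using adapted_measurable[OF X[OF that]] by measurable
    show "\<bar>cosh_generator \<mu> p (X s \<omega>)\<bar> \<le> \<mu> + 3 / 2" for s \<omega>
      using \<mu> p by (intro cosh_generator_bound) auto
    show "Err n \<in> borel_measurable M" unfolding Err_def D_def by measurable
    show "0 \<le> Err n \<omega>" for \<omega> unfolding Err_def using L by simp
    show "AE \<omega> in M. Err n \<omega> \<le> L"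
    proof (rule AE_I2)
      fix \<omega>
      have "L * max 0 (1 - exp (- D n t \<omega>)) \<le> L * 1" by (rule mult_left_mono) (use L in auto)
      then show "Err n \<omega> \<le> L" by (simp add: Err_def)
    qed
    show "AE \<omega> in M. continuous_on {0..t} (\<lambda>u. cosh_generator \<mu> p (X u \<omega>))"
      using Xc by eventually_elim (intro continuous_intros)
    show "AE \<omega> in M. \<exists>c d.
      has_rate t (\<lambda>u. X u \<omega> - B u \<omega>) c \<and> has_rate t (\<lambda>u. D n u \<omega>) d \<and> 0 \<le> D n 0 \<omega> \<and>
      (\<forall>m>0. (\<Sum>k<m. exp (- D n (t * real (Suc k) / real m) \<omega>) *
        ((X (t * real (Suc k) / real m) \<omega> - B (t * real (Suc k) / real m) \<omega>)
          - (X (t * real k / real m) \<omega> - B (t * real k / real m) \<omega>))) \<le> real (Suc n)) \<and>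
      \<bar>integral {0..t} (\<lambda>u. ((p * sinh (X u \<omega>))\<^sup>2 - p * cosh (X u \<omega>)) * exp (- p * cosh (X u \<omega>)) * exp (- D n u \<omega>) / 2)
        + (integral {0..t} (\<lambda>u. - p * sinh (X u \<omega>) * exp (- p * cosh (X u \<omega>)) * exp (- D n u \<omega>) * c u)
          + integral {0..t} (\<lambda>u. - exp (- p * cosh (X u \<omega>)) * exp (- D n u \<omega>) * d u))
        - integral {0..t} (\<lambda>u. cosh_generator \<mu> p (X u \<omega>))\<bar> \<le> Err n \<omega>"
      using paths Xc C0
    proof eventually_elim
      case (elim \<omega>)
      then obtain c N where C: "has_rate t (\<lambda>u. X u \<omega> - B u \<omega>) c" and N: "negligible N"
        "\<forall>u\<in>{0..t} - N. c u * sinh (X u \<omega>) = \<mu> * cosh (X u \<omega>)" by blast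
      define e where "e = 1 / real (Suc n)"
      have e: "e > 0" by (simp add: e_def)
      have B0: "X 0 \<omega> - B 0 \<omega> = x" using elim by (simp add: C_def)
      have D_eq: "D n u \<omega> = e * (X u \<omega> - B u \<omega> - (X 0 \<omega> - B 0 \<omega>))" for u
        unfolding D_def C_def B0 e_def ..
      have D: "has_rate t (\<lambda>u. D n u \<omega>) (\<lambda>u. e * c u)"
      proof (rule has_rateI[where a=0])
        show "(\<lambda>u. e * c u) integrable_on {0..t}"
          using has_rateD(1)[OF C] by (rule integrable_on_mult_right)
        show "0 \<le> e * c u" if "u \<in> {0..t}" for u using has_rateD(2)[OF C that] e by simp
        show "D n s \<omega> = 0 + integral {0..s} (\<lambda>u. e * c u)" if "s \<in> {0..t}" for s
          using has_rateD(3)[OF C, of 0 s] that by (simp add: D_eq)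
      qed
      have D0: "D n 0 \<omega> = 0" using elim by (simp add: D_def)
      have Dt: "0 \<le> D n t \<omega>" using elim by (simp add: D_def)
      have W: "(\<Sum>k<m. exp (- D n (t * real (Suc k) / real m) \<omega>) *
        ((X (t * real (Suc k) / real m) \<omega> - B (t * real (Suc k) / real m) \<omega>)
          - (X (t * real k / real m) \<omega> - B (t * real k / real m) \<omega>))) \<le> real (Suc n)" (is "?S \<le> _") if m: "m > 0" for m
      proof -
        have "e * ?S = (\<Sum>k<m. exp (- D n (t * real (Suc k) / real m) \<omega>) *
            (D n (t * real (Suc k) / real m) \<omega> - D n (t * real k / real m) \<omega>))"
          unfolding sum_distrib_left by (rule sum.cong[OF refl]) (simp add: D_eq algebra_simps)
        also have "\<dots> \<le> exp (- D n 0 \<omega>) - exp (- D n t \<omega>)" by (rule exp_weight_sum[OF m])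
        also have "\<dots> \<le> 1" using D0 by simp
        finally have "e * ?S \<le> 1" .
        then show ?thesis by (simp add: e_def field_simps)
      qed
      have err: "\<bar>integral {0..t} (\<lambda>u. ((p * sinh (X u \<omega>))\<^sup>2 - p * cosh (X u \<omega>)) * exp (- p * cosh (X u \<omega>)) * exp (- D n u \<omega>) / 2)
        + (integral {0..t} (\<lambda>u. - p * sinh (X u \<omega>) * exp (- p * cosh (X u \<omega>)) * exp (- D n u \<omega>) * c u)
          + integral {0..t} (\<lambda>u. - exp (- p * cosh (X u \<omega>)) * exp (- D n u \<omega>) * (e * c u)))
        - integral {0..t} (\<lambda>u. cosh_generator \<mu> p (X u \<omega>))\<bar> \<le> Err n \<omega>"
        using cosh_path_error[OF t elim(2) C N(1) _ e p \<mu>] N(2) Dt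
        unfolding D_eq[symmetric] Err_def L_def by simp
      show ?case
        using C D D0 W err by (intro exI[of _ c] exI[of _ "\<lambda>u. e * c u"]) auto
    qed
  qed
  have D_lim: "(\<lambda>n. D n s \<omega>) \<longlonglongrightarrow> 0" for s \<omega>
  proof -
    have "(\<lambda>n. (1 / real (Suc n)) * C s \<omega>) \<longlonglongrightarrow> 0 * C s \<omega>"
      by (intro tendsto_intros LIMSEQ_Suc[OF lim_1_over_n])
    then show ?thesis by (simp add: D_def)
  qed
  have e1: "exp (- p * cosh r) \<le> 1" for r using p by simp
  have lim_t: "(\<lambda>n. LINT \<omega>|M. exp (- p * cosh (X s \<omega>)) * exp (- D n s \<omega>)) \<longlonglongrightarrow> (LINT \<omega>|M. exp (- p * cosh (X s \<omega>)) * exp (- 0))"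
    if s: "s = 0 \<or> s = t" for s
  proof (rule integral_dominated_convergence[where w="\<lambda>_. 1"])
    have [measurable]: "X s \<in> borel_measurable M" "C s \<in> borel_measurable M" using s by auto
    have [measurable]: "(cosh :: real \<Rightarrow> real) \<in> borel_measurable borel"
      by (auto intro!: borel_measurable_continuous_onI continuous_intros)
    show "(\<lambda>\<omega>. exp (- p * cosh (X s \<omega>)) * exp (- 0)) \<in> borel_measurable M" by measurable
    show "(\<lambda>\<omega>. exp (- p * cosh (X s \<omega>)) * exp (- D n s \<omega>)) \<in> borel_measurable M" for n
      unfolding D_def by measurable
    show "AE \<omega> in M. (\<lambda>n. exp (- p * cosh (X s \<omega>)) * exp (- D n s \<omega>)) \<longlonglongrightarrow> exp (- p * cosh (X s \<omega>)) * exp (- 0)"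
      by (intro AE_I2 tendsto_intros D_lim)
    show "AE \<omega> in M. norm (exp (- p * cosh (X s \<omega>)) * exp (- D n s \<omega>)) \<le> 1" for n
      using C0
    proof eventually_elim
      case (elim \<omega>)
      then have "0 \<le> D n s \<omega>" using s by (auto simp: D_def)
      then have "exp (- p * cosh (X s \<omega>)) * exp (- D n s \<omega>) \<le> 1 * 1"
        using e1 by (intro mult_mono) auto
      then show ?case by simp
    qed
  qed simp
  have lim_Err: "(\<lambda>n. LINT \<omega>|M. Err n \<omega>) \<longlonglongrightarrow> (LINT \<omega>|M. L * max 0 (1 - exp (- 0)))"
  proof (rule integral_dominated_convergence[where w="\<lambda>_. L"])
    show "Err n \<in> borel_measurable M" for n unfolding Err_def D_def by measurable
    show "AE \<omega> in M. (\<lambda>n. Err n \<omega>) \<longlonglongrightarrow> L * max 0 (1 - exp (- 0))"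
      unfolding Err_def by (intro AE_I2 tendsto_intros tendsto_max D_lim)
    show "AE \<omega> in M. norm (Err n \<omega>) \<le> L" for n
    proof (rule AE_I2)
      fix \<omega>
      have "L * max 0 (1 - exp (- D n t \<omega>)) \<le> L * 1" by (rule mult_left_mono) (use L in auto)
      moreover have "0 \<le> L * max 0 (1 - exp (- D n t \<omega>))" using L by simp
      ultimately show "norm (Err n \<omega>) \<le> L" by (simp add: Err_def)
    qed
  qed simp_all
  let ?I = "integral {0..t} (\<lambda>u. LINT \<omega>|M. cosh_generator \<mu> p (X u \<omega>))"
  have "\<bar>(LINT \<omega>|M. exp (- p * cosh (X t \<omega>)) * exp (- 0)) - (LINT \<omega>|M. exp (- p * cosh (X 0 \<omega>)) * exp (- 0)) - ?I\<bar>
    \<le> (LINT \<omega>|M. L * max 0 (1 - exp (- 0)))"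
    by (rule tendsto_le[OF _ lim_Err tendsto_rabs[OF tendsto_diff[OF tendsto_diff[OF lim_t lim_t] tendsto_const]]])
      (use est in auto)
  moreover have "(LINT \<omega>|M. exp (- p * cosh (X 0 \<omega>))) = (LINT \<omega>|M. exp (- p * cosh x))"
  proof (rule integral_cong_AE)
    have [measurable]: "(cosh :: real \<Rightarrow> real) \<in> borel_measurable borel"
      by (auto intro!: borel_measurable_continuous_onI continuous_intros)
    show "(\<lambda>\<omega>. exp (- p * cosh (X 0 \<omega>))) \<in> borel_measurable M" by measurable
    show "AE \<omega> in M. exp (- p * cosh (X 0 \<omega>)) = exp (- p * cosh x)"
      using C0 by eventually_elim simp
  qed simp
  ultimately show ?thesis by (simp add: prob_space)
qed

text \<open>
  The same estimate for \<open>log V\<^sub>u = \<mu> u + B\<^sub>u\<close>, with killing density \<open>\<lambda>\<^sup>2 V\<^sup>2 / 2\<close>. All terms are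
  continuous along every path, so the error term vanishes. The argument \<open>r\<close> is a parameter here; it
  enters through \<open>cosh r\<close> only.
\<close>

lemma expectation_exp_functional:
  assumes t: "t > 0" and lam: "lam > 0" and \<mu>: "\<mu> \<ge> 0"
  defines "V \<equiv> \<lambda>u \<omega>. exp (\<mu> * u + B u \<omega>)"
  defines "D \<equiv> \<lambda>u \<omega>. lam\<^sup>2 / 2 * integral {0..u} (\<lambda>v. (V v \<omega>)\<^sup>2)"
  shows "(LINT \<omega>|M. exp (- (lam * V t \<omega>) * cosh r) * exp (- D t \<omega>)) - exp (- lam * cosh r)
    = integral {0..t} (\<lambda>u. LINT \<omega>|M. cosh_generator \<mu> (lam * V u \<omega>) r * exp (- D u \<omega>))"
proof -
  define q where "q = lam * cosh r"
  have q: "q > 0" using lam by (simp add: q_def)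
  define X where "X u \<omega> = \<mu> * u + B u \<omega>" for u \<omega>
  have XV: "exp (X u \<omega>) = V u \<omega>" for u \<omega> by (simp add: X_def V_def)
  have Vc: "continuous_on {0..u} (\<lambda>v. V v \<omega>)" if "\<omega> \<in> space M" for \<omega> u
    unfolding V_def
    by (intro continuous_intros continuous_on_subset[OF continuous_paths[OF that]]) auto
  have VF: "V v \<in> borel_measurable (F u)" if "0 \<le> v" "v \<le> u" for v u
  proof -
    have [measurable]: "B v \<in> borel_measurable (F u)" by (rule measurable_later[OF adapted that(2)]) (rule that(1))
    show ?thesis unfolding V_def by measurable
  qed
  have XF: "X u \<in> borel_measurable (F u)" if "u \<in> {0..t}" for u
  proof -
    have [measurable]: "B u \<in> borel_measurable (F u)" using adapted that by simp
    show ?thesis unfolding X_def by measurable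
  qed
  have DF: "D u \<in> borel_measurable (F u)" if "u \<in> {0..t}" for u
    unfolding D_def
    by (intro borel_measurable_times borel_measurable_const integral_process_measurable borel_measurable_power VF
      continuous_intros Vc) (use that space_F in auto)
  have V0: "AE \<omega> in M. V 0 \<omega> = 1"
    using starts_at_zero by eventually_elim (simp add: V_def)
  have D0: "D 0 \<omega> = 0" for \<omega> by (simp add: D_def)
  have Vpos: "V u \<omega> > 0" for u \<omega> by (simp add: V_def)
  have rate: "has_rate t (\<lambda>u. D u \<omega>) (\<lambda>u. lam\<^sup>2 / 2 * (V u \<omega>)\<^sup>2)" if "\<omega> \<in> space M" for \<omega>
  proof (rule has_rateI[where a=0])
    show "(\<lambda>u. lam\<^sup>2 / 2 * (V u \<omega>)\<^sup>2) integrable_on {0..t}"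
      by (intro integrable_continuous_real continuous_intros Vc[OF that])
  qed (simp_all add: D_def)
  have Dpos: "0 \<le> D u \<omega>" if "\<omega> \<in> space M" "u \<in> {0..t}" for u \<omega>
    using has_rate_mono[OF rate[OF that(1)], of 0 u] that D0 by auto
  define Y where "Y u \<omega> = cosh_generator \<mu> (lam * V u \<omega>) r * exp (- D u \<omega>)" for u \<omega>
  have "\<bar>(LINT \<omega>|M. exp (- q * exp (X t \<omega>)) * exp (- D t \<omega>)) - (LINT \<omega>|M. exp (- q * exp (X 0 \<omega>)) * exp (- D 0 \<omega>))
    - integral {0..t} (\<lambda>u. LINT \<omega>|M. Y u \<omega>)\<bar> \<le> (LINT \<omega>|M. 0)"
  proof (rule dynkin_estimate[OF C3_bounded_exp_exp[OF less_imp_le[OF q]] t XF DF,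
        where L="\<mu> + 3 / 2" and L'=0 and W="\<mu> * t"])
    show "Y s \<in> borel_measurable M" if "s \<in> {0..t}" for s
    proof -
      have [measurable]: "V s \<in> borel_measurable M" "D s \<in> borel_measurable M"
        using adapted_measurable[OF VF[of s s]] adapted_measurable[OF DF[OF that]] that by auto
      show ?thesis unfolding Y_def by measurable
    qed
    show "\<bar>Y s \<omega>\<bar> \<le> \<mu> + 3 / 2" if "s \<in> {0..t}" "\<omega> \<in> space M" for s \<omega>
    proof -
      have "\<bar>cosh_generator \<mu> (lam * V s \<omega>) r\<bar> * exp (- D s \<omega>) \<le> (\<mu> + 3 / 2) * 1"
        using Dpos[OF that(2,1)] \<mu> lam Vpos[of s \<omega>] by (intro mult_mono cosh_generator_bound) auto
      then show ?thesis by (simp add: Y_def abs_mult)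
    qed
    show "AE \<omega> in M. continuous_on {0..t} (\<lambda>u. Y u \<omega>)"
    proof (rule AE_I2)
      fix \<omega> assume "\<omega> \<in> space M"
      then show "continuous_on {0..t} (\<lambda>u. Y u \<omega>)"
        unfolding Y_def by (intro continuous_intros Vc has_rate_continuous[OF rate])
    qed
    show "AE \<omega> in M. \<exists>c d.
      has_rate t (\<lambda>u. X u \<omega> - B u \<omega>) c \<and> has_rate t (\<lambda>u. D u \<omega>) d \<and> 0 \<le> D 0 \<omega> \<and>
      (\<forall>m>0. (\<Sum>k<m. exp (- D (t * real (Suc k) / real m) \<omega>) *
        ((X (t * real (Suc k) / real m) \<omega> - B (t * real (Suc k) / real m) \<omega>)
          - (X (t * real k / real m) \<omega> - B (t * real k / real m) \<omega>))) \<le> \<mu> * t) \<and>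
      \<bar>integral {0..t} (\<lambda>u. ((q * exp (X u \<omega>))\<^sup>2 - q * exp (X u \<omega>)) * exp (- q * exp (X u \<omega>)) * exp (- D u \<omega>) / 2)
        + (integral {0..t} (\<lambda>u. - (q * exp (X u \<omega>)) * exp (- q * exp (X u \<omega>)) * exp (- D u \<omega>) * c u)
          + integral {0..t} (\<lambda>u. - exp (- q * exp (X u \<omega>)) * exp (- D u \<omega>) * d u))
        - integral {0..t} (\<lambda>u. Y u \<omega>)\<bar> \<le> 0"
    proof (rule AE_I2, intro exI conjI allI impI)
      fix \<omega> assume \<omega>: "\<omega> \<in> space M"
      let ?d = "\<lambda>u. lam\<^sup>2 / 2 * (V u \<omega>)\<^sup>2"
      note Vc' = Vc[OF \<omega>] and Dc = has_rate_continuous[OF rate[OF \<omega>]]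
      show "has_rate t (\<lambda>u. X u \<omega> - B u \<omega>) (\<lambda>_. \<mu>)"
        by (rule has_rateI[where a=0]) (use \<mu> in \<open>auto simp: X_def\<close>)
      show "has_rate t (\<lambda>u. D u \<omega>) ?d" by (rule rate[OF \<omega>])
      show "0 \<le> D 0 \<omega>" by (simp add: D0)
      show "(\<Sum>k<m. exp (- D (t * real (Suc k) / real m) \<omega>) *
        ((X (t * real (Suc k) / real m) \<omega> - B (t * real (Suc k) / real m) \<omega>)
          - (X (t * real k / real m) \<omega> - B (t * real k / real m) \<omega>))) \<le> \<mu> * t" if m: "m > 0" for m :: nat
      proof -
        have "(\<Sum>k<m. exp (- D (t * real (Suc k) / real m) \<omega>) *
            ((X (t * real (Suc k) / real m) \<omega> - B (t * real (Suc k) / real m) \<omega>)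
              - (X (t * real k / real m) \<omega> - B (t * real k / real m) \<omega>))) \<le> (\<Sum>k<m. 1 * (\<mu> * (t / real m)))"
        proof (rule sum_mono)
          fix k assume "k \<in> {..<m}"
          then have "0 \<le> D (t * real (Suc k) / real m) \<omega>"
            using grid_bounds[of t k m] t by (intro Dpos[OF \<omega>]) auto
          moreover have "(X (t * real (Suc k) / real m) \<omega> - B (t * real (Suc k) / real m) \<omega>)
              - (X (t * real k / real m) \<omega> - B (t * real k / real m) \<omega>) = \<mu> * (t / real m)"
            unfolding grid_step[of t k m, symmetric] by (simp add: X_def algebra_simps)
          ultimately show "exp (- D (t * real (Suc k) / real m) \<omega>) *
            ((X (t * real (Suc k) / real m) \<omega> - B (t * real (Suc k) / real m) \<omega>)
              - (X (t * real k / real m) \<omega> - B (t * real k / real m) \<omega>)) \<le> 1 * (\<mu> * (t / real m))"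
            using \<mu> t by (simp only:) (intro mult_right_mono, auto)
        qed
        then show ?thesis using m by simp
      qed
      let ?a = "\<lambda>u. ((q * V u \<omega>)\<^sup>2 - q * V u \<omega>) * exp (- q * V u \<omega>) * exp (- D u \<omega>) / 2"
      let ?b = "\<lambda>u. - (q * V u \<omega>) * exp (- q * V u \<omega>) * exp (- D u \<omega>) * \<mu>"
      let ?c = "\<lambda>u. - exp (- q * V u \<omega>) * exp (- D u \<omega>) * ?d u"
      have i: "?a integrable_on {0..t}" "?b integrable_on {0..t}" "?c integrable_on {0..t}"
        by (intro integrable_continuous_real continuous_intros Vc' Dc; simp)+
      have "integral {0..t} (\<lambda>u. Y u \<omega>) = integral {0..t} (\<lambda>u. ?a u + (?b u + ?c u))"
      proof (rule integral_cong)
        fix u assume u: "u \<in> {0..t}"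
        \<comment> \<open>the killing term completes \<open>(cosh r)\<^sup>2\<close> to \<open>(sinh r)\<^sup>2\<close>\<close>
        have s: "(sinh r)\<^sup>2 = (cosh r)\<^sup>2 - 1" by (simp add: cosh_square_eq)
        show "Y u \<omega> = ?a u + (?b u + ?c u)"
          unfolding Y_def cosh_generator_def q_def power_mult_distrib s
          by (simp add: field_simps)
      qed
      also have "\<dots> = integral {0..t} ?a + (integral {0..t} ?b + integral {0..t} ?c)"
        unfolding Henstock_Kurzweil_Integration.integral_add[OF i(1) integrable_add[OF i(2,3)]]
          Henstock_Kurzweil_Integration.integral_add[OF i(2,3)] ..
      finally show "\<bar>integral {0..t} (\<lambda>u. ((q * exp (X u \<omega>))\<^sup>2 - q * exp (X u \<omega>)) * exp (- q * exp (X u \<omega>)) * exp (- D u \<omega>) / 2)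
        + (integral {0..t} (\<lambda>u. - (q * exp (X u \<omega>)) * exp (- q * exp (X u \<omega>)) * exp (- D u \<omega>) * \<mu>)
          + integral {0..t} (\<lambda>u. - exp (- q * exp (X u \<omega>)) * exp (- D u \<omega>) * ?d u))
        - integral {0..t} (\<lambda>u. Y u \<omega>)\<bar> \<le> 0"
        unfolding XV by simp
    qed
  qed auto
  moreover have "(LINT \<omega>|M. exp (- q * exp (X 0 \<omega>)) * exp (- D 0 \<omega>)) = (LINT \<omega>|M. exp (- q))"
  proof (rule integral_cong_AE)
    have [measurable]: "X 0 \<in> borel_measurable M" "D 0 \<in> borel_measurable M"
      using adapted_measurable[OF XF[of 0]] adapted_measurable[OF DF[of 0]] t by auto
    show "(\<lambda>\<omega>. exp (- q * exp (X 0 \<omega>)) * exp (- D 0 \<omega>)) \<in> borel_measurable M" by measurable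
    show "AE \<omega> in M. exp (- q * exp (X 0 \<omega>)) * exp (- D 0 \<omega>) = exp (- q)"
      using V0 by eventually_elim (simp add: XV D0)
  qed simp
  ultimately show ?thesis
    by (simp add: XV q_def Y_def prob_space mult.commute mult.left_commute)
qed

end

section \<open>Duality\<close>

lemma integral_close_to_constant:
  fixes g :: "real \<Rightarrow> real"
  assumes "a \<le> b" "continuous_on {a..b} g" "\<And>u. u \<in> {a..b} \<Longrightarrow> \<bar>g u - v\<bar> \<le> e"
  shows "\<bar>integral {a..b} g - v * (b - a)\<bar> \<le> e * (b - a)"
proof -
  have "integral {a..b} (\<lambda>u. g u - v) = integral {a..b} g - integral {a..b} (\<lambda>_. v)"
    by (rule Henstock_Kurzweil_Integration.integral_diff)
      (use integrable_continuous_real[OF assms(2)] in auto)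
  also have "\<dots> = integral {a..b} g - v * (b - a)" using assms(1) by simp
  finally have eq: "integral {a..b} (\<lambda>u. g u - v) = integral {a..b} g - v * (b - a)" .
  have "norm (integral {a..b} (\<lambda>u. g u - v)) \<le> e * (b - a)"
    by (rule integral_bound) (use assms in \<open>auto intro!: continuous_intros\<close>)
  then show ?thesis unfolding eq by simp
qed

text \<open>
  If \<open>\<phi>\<close> has the partial derivative \<open>\<psi>\<close> in both arguments, it is constant along
  \<open>s + \<tau> = t\<close>. Moving along the antidiagonal by \<open>h\<close>, the first argument contributes \<open>h \<psi>\<close> and the
  second \<open>- h \<psi>\<close>, each up to \<open>h\<close> times the oscillation of \<open>\<psi>\<close> on a square of side \<open>h\<close>; uniform
  continuity makes the sum of these errors over a grid small.
\<close>

lemma equal_partials_antidiagonal: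
  fixes \<phi> \<psi> :: "real \<Rightarrow> real \<Rightarrow> real"
  assumes t: "t > 0" and cont: "continuous_on ({0..t} \<times> {0..t}) (\<lambda>z. \<psi> (fst z) (snd z))"
    and d1: "\<And>s \<tau>. s \<in> {0..t} \<Longrightarrow> \<tau> \<in> {0..t} \<Longrightarrow> \<phi> s \<tau> - \<phi> 0 \<tau> = integral {0..s} (\<lambda>u. \<psi> u \<tau>)"
    and d2: "\<And>s \<tau>. s \<in> {0..t} \<Longrightarrow> \<tau> \<in> {0..t} \<Longrightarrow> \<phi> s \<tau> - \<phi> s 0 = integral {0..\<tau>} (\<lambda>u. \<psi> s u)"
  shows "\<phi> t 0 = \<phi> 0 t"
proof -
  have c1: "continuous_on {a..b} (\<lambda>u. \<psi> u \<tau>)" if "0 \<le> a" "b \<le> t" "\<tau> \<in> {0..t}" for a b \<tau>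
    by (rule continuous_on_compose2[OF cont, of _ "\<lambda>u. (u, \<tau>)", simplified])
      (use that in \<open>auto intro!: continuous_intros\<close>)
  have c2: "continuous_on {a..b} (\<lambda>u. \<psi> s u)" if "0 \<le> a" "b \<le> t" "s \<in> {0..t}" for a b s
    by (rule continuous_on_compose2[OF cont, of _ "\<lambda>u. (s, u)", simplified])
      (use that in \<open>auto intro!: continuous_intros\<close>)
  have i1: "\<phi> b \<tau> - \<phi> a \<tau> = integral {a..b} (\<lambda>u. \<psi> u \<tau>)" if "0 \<le> a" "a \<le> b" "b \<le> t" "\<tau> \<in> {0..t}" for a b \<tau>
    using d1[of a \<tau>] d1[of b \<tau>] that
      Henstock_Kurzweil_Integration.integral_combine[OF that(1,2) integrable_continuous_real[OF c1[of 0 b \<tau>]]]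
    by auto
  have i2: "\<phi> s b - \<phi> s a = integral {a..b} (\<lambda>u. \<psi> s u)" if "0 \<le> a" "a \<le> b" "b \<le> t" "s \<in> {0..t}" for a b s
    using d2[of s a] d2[of s b] that
      Henstock_Kurzweil_Integration.integral_combine[OF that(1,2) integrable_continuous_real[OF c2[of 0 b s]]]
    by auto
  have "\<bar>\<phi> t 0 - \<phi> 0 t\<bar> \<le> 0 + e" if e: "e > 0" for e
  proof -
    \<comment> \<open>a cell of width \<open>t / n\<close> costs \<open>e' * (t / n)\<close> for each of the two arguments\<close>
    define e' where "e' = e / (2 * t)"
    have e': "e' > 0" using e t by (simp add: e'_def)
    have "uniformly_continuous_on ({0..t} \<times> {0..t}) (\<lambda>z. \<psi> (fst z) (snd z))"
      by (rule compact_uniformly_continuous[OF cont]) (intro compact_Times compact_Icc)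
    then obtain d where d: "d > 0" "\<And>z z'. z \<in> {0..t} \<times> {0..t} \<Longrightarrow> z' \<in> {0..t} \<times> {0..t} \<Longrightarrow>
        dist z' z < d \<Longrightarrow> dist (\<psi> (fst z') (snd z')) (\<psi> (fst z) (snd z)) < e'"
      unfolding uniformly_continuous_on_def using e' by metis
    have step: "\<bar>\<phi> b (t - b) - \<phi> a (t - a)\<bar> \<le> 2 * e' * (b - a)"
      if ab: "0 \<le> a" "a \<le> b" "b \<le> t" "2 * (b - a) < d" for a b
    proof -
      have near: "\<bar>\<psi> u v - \<psi> a (t - a)\<bar> \<le> e'" if "u \<in> {a..b}" "v \<in> {t - b..t - a}" for u v
      proof -
        have "dist (u, v) (a, t - a) \<le> dist u a + dist v (t - a)"
          unfolding dist_Pair_Pair by (rule sqrt_sum_squares_le_sum) auto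
        also have "\<dots> \<le> (b - a) + (b - a)" using that by (intro add_mono) (auto simp: dist_real_def)
        also have "\<dots> < d" using ab by simp
        finally have "dist (u, v) (a, t - a) < d" .
        from d(2)[OF _ _ this] that ab show ?thesis by (simp add: dist_real_def)
      qed
      have "\<phi> b (t - b) - \<phi> a (t - b) = integral {a..b} (\<lambda>u. \<psi> u (t - b))"
        by (rule i1) (use ab in auto)
      moreover have "\<bar>integral {a..b} (\<lambda>u. \<psi> u (t - b)) - \<psi> a (t - a) * (b - a)\<bar> \<le> e' * (b - a)"
        by (rule integral_close_to_constant) (use ab near c1 in auto)
      moreover have "\<phi> a (t - a) - \<phi> a (t - b) = integral {t - b..t - a} (\<lambda>u. \<psi> a u)"
        by (rule i2) (use ab in auto)
      moreover have "\<bar>integral {t - b..t - a} (\<lambda>u. \<psi> a u) - \<psi> a (t - a) * ((t - a) - (t - b))\<bar>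
          \<le> e' * ((t - a) - (t - b))"
        by (rule integral_close_to_constant) (use ab near c2 in auto)
      ultimately show ?thesis by (simp add: algebra_simps)
    qed
    have "(\<lambda>n. t / real n) \<longlonglongrightarrow> 0" by (rule lim_const_over_n)
    then have "\<forall>\<^sub>F n in sequentially. t / real n < d / 2" using d(1) by (intro order_tendstoD) auto
    then have "\<forall>\<^sub>F n in sequentially. t / real n < d / 2 \<and> 0 < n"
      using eventually_gt_at_top[of 0] by eventually_elim auto
    then obtain n where n: "t / real n < d / 2" "0 < n" 
      using eventually_happens'[OF sequentially_bot] by blast
    let ?g = "\<lambda>k. t * real k / real n"
    have "\<phi> t 0 - \<phi> 0 t = (\<Sum>k<n. \<phi> (?g (Suc k)) (t - ?g (Suc k)) - \<phi> (?g k) (t - ?g k))"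
      using sum_lessThan_telescope[of "\<lambda>k. \<phi> (?g k) (t - ?g k)" n] n by simp
    then have "\<bar>\<phi> t 0 - \<phi> 0 t\<bar> = \<bar>\<Sum>k<n. \<phi> (?g (Suc k)) (t - ?g (Suc k)) - \<phi> (?g k) (t - ?g k)\<bar>"
      by (rule arg_cong)
    also have "\<dots> \<le> (\<Sum>k<n. 2 * e' * (t / real n))"
    proof (rule order_trans[OF sum_abs sum_mono])
      fix k assume "k \<in> {..<n}"
      then have k: "k < n" by simp
      show "\<bar>\<phi> (?g (Suc k)) (t - ?g (Suc k)) - \<phi> (?g k) (t - ?g k)\<bar> \<le> 2 * e' * (t / real n)"
        using step[OF grid_bounds[OF less_imp_le[OF t] k]] n unfolding grid_step by simp
    qed
    also have "\<dots> = e" using n t by (simp add: e'_def)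
    finally show ?thesis by simp
  qed
  then have "\<bar>\<phi> t 0 - \<phi> 0 t\<bar> \<le> 0" by (rule field_le_epsilon)
  then show ?thesis by simp
qed

text \<open>
  The duality for a process \<open>X\<close> that need not be nonnegative: only \<open>cosh X\<close> matters, and this allows
  \<open>X = x + B\<close> in place of its absolute value.
\<close>

lemma expectation_duality:
  fixes M :: "'a measure" and N :: "'b measure"
  assumes M: "brownian_motion M F B" and N: "brownian_motion N G W"
    and t: "t > 0" and lam: "lam > 0" and \<mu>: "\<mu> \<ge> 0"
    and X: "\<And>s. s \<in> {0..t} \<Longrightarrow> X s \<in> borel_measurable (F s)"
    and paths: "AE \<omega> in M. X 0 \<omega> = x \<and> (\<exists>c Z. has_rate t (\<lambda>u. X u \<omega> - B u \<omega>) c \<and> negligible Z \<and>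
      (\<forall>u\<in>{0..t} - Z. c u * sinh (X u \<omega>) = \<mu> * cosh (X u \<omega>)))"
  defines "V \<equiv> \<lambda>u \<omega>. exp (\<mu> * u + W u \<omega>)"
  shows "(LINT \<omega>|M. exp (- lam * cosh (X t \<omega>))) =
    (LINT \<omega>|N. exp (- lam * cosh x * V t \<omega> - lam\<^sup>2 / 2 * integral {0..t} (\<lambda>u. (V u \<omega>)\<^sup>2)))"
proof -
  interpret M: brownian_motion M F B by fact
  interpret N: brownian_motion N G W by fact
  interpret MN: pair_prob_space M N ..
  define D where "D u \<omega> = lam\<^sup>2 / 2 * integral {0..u} (\<lambda>v. (V v \<omega>)\<^sup>2)" for u \<omega>
  define H where "H s \<tau> \<omega> \<omega>' = exp (- (lam * V \<tau> \<omega>') * cosh (X s \<omega>)) * exp (- D \<tau> \<omega>')" for s \<tau> \<omega> \<omega>'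
  define P where "P s \<tau> \<omega> \<omega>' = cosh_generator \<mu> (lam * V \<tau> \<omega>') (X s \<omega>) * exp (- D \<tau> \<omega>')" for s \<tau> \<omega> \<omega>'
  \<comment> \<open>The iterated expectations stand for independent copies; the order of integration is exchanged
    where the equation for \<open>V\<close> is used.\<close>
  define \<phi> where "\<phi> s \<tau> = (LINT \<omega>'|N. LINT \<omega>|M. H s \<tau> \<omega> \<omega>')" for s \<tau>
  define \<psi> where "\<psi> s \<tau> = (LINT \<omega>'|N. LINT \<omega>|M. P s \<tau> \<omega> \<omega>')" for s \<tau>
  define L where "L = \<mu> + 3 / 2"
  have Xm: "X s \<in> borel_measurable M" if "s \<in> {0..t}" for s
    using M.adapted_measurable[OF X[OF that]] .
  have Vpos: "V u \<omega> > 0" for u \<omega> by (simp add: V_def)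
  have Vc: "continuous_on {0..u} (\<lambda>v. V v \<omega>)" if "\<omega> \<in> space N" for \<omega> u
    unfolding V_def
    by (intro continuous_intros continuous_on_subset[OF N.continuous_paths[OF that]]) auto
  have Vm: "V u \<in> borel_measurable N" if "u \<ge> 0" for u
  proof -
    have [measurable]: "W u \<in> borel_measurable N" by (rule N.adapted_measurable[OF N.adapted[OF that]])
    show ?thesis unfolding V_def by measurable
  qed
  have Dm: "D u \<in> borel_measurable N" if "u \<ge> 0" for u
    unfolding D_def
    by (intro borel_measurable_times borel_measurable_const integral_process_measurable borel_measurable_power Vm
      continuous_intros Vc) (use that in auto)
  have Dc: "continuous_on {0..t} (\<lambda>u. D u \<omega>)" if "\<omega> \<in> space N" for \<omega>
    unfolding D_def
    by (intro continuous_intros indefinite_integral_continuous_1 integrable_continuous_real Vc that)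
  have Dpos: "0 \<le> D u \<omega>" if "\<omega> \<in> space N" for u \<omega>
    unfolding D_def
    by (intro mult_nonneg_nonneg integral_nonneg integrable_continuous_real continuous_intros Vc[OF that]) auto
  have Hb: "\<bar>H s \<tau> \<omega> \<omega>'\<bar> \<le> 1" if "\<omega>' \<in> space N" for s \<tau> \<omega> \<omega>'
  proof -
    have "exp (- (lam * V \<tau> \<omega>') * cosh (X s \<omega>)) * exp (- D \<tau> \<omega>') \<le> 1 * 1"
      using Dpos[OF that] lam Vpos[of \<tau> \<omega>'] by (intro mult_mono) auto
    then show ?thesis by (simp add: H_def)
  qed
  have Pb: "\<bar>P s \<tau> \<omega> \<omega>'\<bar> \<le> L" if "\<omega>' \<in> space N" for s \<tau> \<omega> \<omega>'
  proof -
    have "\<bar>cosh_generator \<mu> (lam * V \<tau> \<omega>') (X s \<omega>)\<bar> * exp (- D \<tau> \<omega>') \<le> L * 1"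
      unfolding L_def using Dpos[OF that] lam \<mu> Vpos[of \<tau> \<omega>'] by (intro mult_mono cosh_generator_bound) auto
    then show ?thesis by (simp add: P_def abs_mult)
  qed
  have cosh_m [measurable]: "(cosh :: real \<Rightarrow> real) \<in> borel_measurable borel"
    by (auto intro!: borel_measurable_continuous_onI continuous_intros)
  have Hm: "(\<lambda>z. H s \<tau> (fst z) (snd z)) \<in> borel_measurable (M \<Otimes>\<^sub>M N)"
    and Pm: "(\<lambda>z. P s \<tau> (fst z) (snd z)) \<in> borel_measurable (M \<Otimes>\<^sub>M N)"
    if "s \<in> {0..t}" "\<tau> \<in> {0..t}" for s \<tau>
  proof -
    have [measurable]: "X s \<in> borel_measurable M" "V \<tau> \<in> borel_measurable N" "D \<tau> \<in> borel_measurable N"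
      using that Xm Vm Dm by auto
    show "(\<lambda>z. H s \<tau> (fst z) (snd z)) \<in> borel_measurable (M \<Otimes>\<^sub>M N)" unfolding H_def by measurable
    show "(\<lambda>z. P s \<tau> (fst z) (snd z)) \<in> borel_measurable (M \<Otimes>\<^sub>M N)" unfolding P_def by measurable
  qed
  have fubini: "(LINT \<omega>|M. LINT \<omega>'|N. h \<omega> \<omega>') = (LINT \<omega>'|N. LINT \<omega>|M. h \<omega> \<omega>')"
    if "(\<lambda>z. h (fst z) (snd z)) \<in> borel_measurable (M \<Otimes>\<^sub>M N)" "\<And>\<omega> \<omega>'. \<omega>' \<in> space N \<Longrightarrow> \<bar>h \<omega> \<omega>'\<bar> \<le> K"
    for h :: "'a \<Rightarrow> 'b \<Rightarrow> real" and K
  proof -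
    have "integrable (M \<Otimes>\<^sub>M N) (\<lambda>z. h (fst z) (snd z))"
      by (rule MN.integrable_const_bound[where B=K]) (use that in \<open>auto simp: space_pair_measure\<close>)
    then show ?thesis
      using MN.Fubini_integral[of h] by (simp add: case_prod_beta')
  qed
  have Hm1: "(\<lambda>\<omega>. H s \<tau> \<omega> \<omega>') \<in> borel_measurable M" and Pm1: "(\<lambda>\<omega>. P s \<tau> \<omega> \<omega>') \<in> borel_measurable M"
    if "s \<in> {0..t}" for s \<tau> \<omega>'
  proof -
    have [measurable]: "X s \<in> borel_measurable M" using that Xm by auto
    show "(\<lambda>\<omega>. H s \<tau> \<omega> \<omega>') \<in> borel_measurable M" unfolding H_def by measurable
    show "(\<lambda>\<omega>. P s \<tau> \<omega> \<omega>') \<in> borel_measurable M" unfolding P_def by measurable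
  qed
  have Hm2: "(\<lambda>\<omega>'. H s \<tau> \<omega> \<omega>') \<in> borel_measurable N" and Pm2: "(\<lambda>\<omega>'. P s \<tau> \<omega> \<omega>') \<in> borel_measurable N"
    if "\<tau> \<in> {0..t}" for s \<tau> \<omega>
  proof -
    have [measurable]: "V \<tau> \<in> borel_measurable N" "D \<tau> \<in> borel_measurable N" using that Vm Dm by auto
    show "(\<lambda>\<omega>'. H s \<tau> \<omega> \<omega>') \<in> borel_measurable N" unfolding H_def by measurable
    show "(\<lambda>\<omega>'. P s \<tau> \<omega> \<omega>') \<in> borel_measurable N" unfolding P_def by measurable
  qed
  have EPm: "(\<lambda>\<omega>'. LINT \<omega>|M. P s \<tau> \<omega> \<omega>') \<in> borel_measurable N"
    and EHm: "(\<lambda>\<omega>'. LINT \<omega>|M. H s \<tau> \<omega> \<omega>') \<in> borel_measurable N"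
    and EPm': "(\<lambda>\<omega>. LINT \<omega>'|N. P s \<tau> \<omega> \<omega>') \<in> borel_measurable M"
    and EHm': "(\<lambda>\<omega>. LINT \<omega>'|N. H s \<tau> \<omega> \<omega>') \<in> borel_measurable M"
    if "s \<in> {0..t}" "\<tau> \<in> {0..t}" for s \<tau>
  proof -
    have swap: "(\<lambda>z. (snd z, fst z)) \<in> measurable (N \<Otimes>\<^sub>M M) (M \<Otimes>\<^sub>M N)" by measurable
    show "(\<lambda>\<omega>'. LINT \<omega>|M. P s \<tau> \<omega> \<omega>') \<in> borel_measurable N"
      using measurable_compose[OF swap Pm[OF that]]
      by (intro M.borel_measurable_lebesgue_integral) (simp add: case_prod_beta')
    show "(\<lambda>\<omega>'. LINT \<omega>|M. H s \<tau> \<omega> \<omega>') \<in> borel_measurable N"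
      using measurable_compose[OF swap Hm[OF that]]
      by (intro M.borel_measurable_lebesgue_integral) (simp add: case_prod_beta')
    show "(\<lambda>\<omega>. LINT \<omega>'|N. P s \<tau> \<omega> \<omega>') \<in> borel_measurable M"
      using Pm[OF that] by (intro N.borel_measurable_lebesgue_integral) (simp add: case_prod_beta')
    show "(\<lambda>\<omega>. LINT \<omega>'|N. H s \<tau> \<omega> \<omega>') \<in> borel_measurable M"
      using Hm[OF that] by (intro N.borel_measurable_lebesgue_integral) (simp add: case_prod_beta')
  qed
  have Xc: "AE \<omega> in M. continuous_on {0..t} (\<lambda>u. X u \<omega>)"
    by (rule M.has_rate_paths_continuous) (use paths in \<open>eventually_elim, blast\<close>)
  have VDc: "continuous_on ({0..t} \<times> {0..t}) (\<lambda>z. V (snd z) \<omega>)" "continuous_on ({0..t} \<times> {0..t}) (\<lambda>z. D (snd z) \<omega>)"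
    if "\<omega> \<in> space N" for \<omega>
    by (rule continuous_on_compose2[OF Vc[OF that, of t]] continuous_on_compose2[OF Dc[OF that]];
        auto intro!: continuous_intros)+
  have inner: "continuous_on ({0..t} \<times> {0..t}) (\<lambda>z. LINT \<omega>|M. P (fst z) (snd z) \<omega> \<omega>')"
    if \<omega>': "\<omega>' \<in> space N" for \<omega>'
  proof (rule expectation_continuous_on[OF M.prob_space_axioms, where K=L])
    show "AE \<omega> in M. continuous_on ({0..t} \<times> {0..t}) (\<lambda>z. P (fst z) (snd z) \<omega> \<omega>')"
      using Xc
    proof eventually_elim
      case (elim \<omega>)
      have "continuous_on ({0..t} \<times> {0..t}) (\<lambda>z. X (fst z) \<omega>)"
        by (rule continuous_on_compose2[OF elim]) (auto intro!: continuous_intros)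
      then show ?case unfolding P_def by (intro continuous_intros VDc[OF \<omega>'])
    qed
  qed (use Pm1 Pb \<omega>' in auto)
  have \<psi>_cont: "continuous_on ({0..t} \<times> {0..t}) (\<lambda>z. \<psi> (fst z) (snd z))"
    unfolding \<psi>_def
  proof (rule expectation_continuous_on[OF N.prob_space_axioms, where K=L])
    show "AE \<omega>' in N. continuous_on ({0..t} \<times> {0..t}) (\<lambda>z. LINT \<omega>|M. P (fst z) (snd z) \<omega> \<omega>')"
      by (intro AE_I2 inner)
  qed (use EPm Pm1 Pb in \<open>auto intro!: M.abs_expectation_le\<close>)
  have start: "(LINT \<omega>|M. H 0 \<tau> \<omega> \<omega>') = exp (- (lam * V \<tau> \<omega>') * cosh x) * exp (- D \<tau> \<omega>')" for \<tau> \<omega>'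
  proof -
    have "(LINT \<omega>|M. H 0 \<tau> \<omega> \<omega>') = (LINT \<omega>|M. exp (- (lam * V \<tau> \<omega>') * cosh x) * exp (- D \<tau> \<omega>'))"
    proof (rule integral_cong_AE)
      show "AE \<omega> in M. H 0 \<tau> \<omega> \<omega>' = exp (- (lam * V \<tau> \<omega>') * cosh x) * exp (- D \<tau> \<omega>')"
        using paths by eventually_elim (simp add: H_def)
    qed (use Hm1[of 0] t in auto)
    then show ?thesis by (simp add: M.prob_space)
  qed
  have d1: "\<phi> s \<tau> - \<phi> 0 \<tau> = integral {0..s} (\<lambda>u. \<psi> u \<tau>)" if s: "s \<in> {0..t}" and \<tau>: "\<tau> \<in> {0..t}" for s \<tau>
  proof (cases "s = 0")
    case True
    then show ?thesis by simp
  next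
    case False
    with s have s0: "s > 0" by simp
    have inner_eq: "(LINT \<omega>|M. H s \<tau> \<omega> \<omega>') - (LINT \<omega>|M. H 0 \<tau> \<omega> \<omega>') = integral {0..s} (\<lambda>u. LINT \<omega>|M. P u \<tau> \<omega> \<omega>')" for \<omega>'
    proof -
      have pv: "lam * V \<tau> \<omega>' > 0" using lam Vpos by simp
      have "AE \<omega> in M. X 0 \<omega> = x \<and> (\<exists>c Z. has_rate s (\<lambda>u. X u \<omega> - B u \<omega>) c \<and> negligible Z \<and>
          (\<forall>u\<in>{0..s} - Z. c u * sinh (X u \<omega>) = \<mu> * cosh (X u \<omega>)))"
        using paths
      proof eventually_elim
        case (elim \<omega>)
        then obtain c Z where "X 0 \<omega> = x" "has_rate t (\<lambda>u. X u \<omega> - B u \<omega>) c" "negligible Z"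
          "\<forall>u\<in>{0..t} - Z. c u * sinh (X u \<omega>) = \<mu> * cosh (X u \<omega>)" by blast
        then show ?case
          using has_rate_subset[of t _ c s] s by (intro conjI exI[of _ c] exI[of _ Z]) auto
      qed
      from M.expectation_exp_cosh[OF s0 pv \<mu> _ this] X s
      have "(LINT \<omega>|M. exp (- (lam * V \<tau> \<omega>') * cosh (X s \<omega>))) - exp (- (lam * V \<tau> \<omega>') * cosh x)
          = integral {0..s} (\<lambda>u. LINT \<omega>|M. cosh_generator \<mu> (lam * V \<tau> \<omega>') (X u \<omega>))" by auto
      then have "((LINT \<omega>|M. exp (- (lam * V \<tau> \<omega>') * cosh (X s \<omega>))) - exp (- (lam * V \<tau> \<omega>') * cosh x)) * exp (- D \<tau> \<omega>')
          = integral {0..s} (\<lambda>u. LINT \<omega>|M. cosh_generator \<mu> (lam * V \<tau> \<omega>') (X u \<omega>)) * exp (- D \<tau> \<omega>')"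
        by (rule arg_cong)
      then show ?thesis
        unfolding start by (simp add: H_def P_def left_diff_distrib)
    qed
    have Hi: "integrable N (\<lambda>\<omega>'. LINT \<omega>|M. H s' \<tau> \<omega> \<omega>')" if "s' \<in> {0..t}" for s'
      by (rule N.integrable_const_bound[where B=1]) (use EHm[OF that \<tau>] Hm1[OF that] Hb in \<open>auto intro!: M.abs_expectation_le\<close>)
    have "\<phi> s \<tau> - \<phi> 0 \<tau> = (LINT \<omega>'|N. integral {0..s} (\<lambda>u. LINT \<omega>|M. P u \<tau> \<omega> \<omega>'))"
      unfolding \<phi>_def inner_eq[symmetric] using Hi[OF s] Hi[of 0] t by simp
    also have "\<dots> = integral {0..s} (\<lambda>u. LINT \<omega>'|N. LINT \<omega>|M. P u \<tau> \<omega> \<omega>')"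
    proof (rule expectation_integral_swap[OF N.prob_space_axioms, where K=L])
      show "continuous_on {0..s} (\<lambda>u. LINT \<omega>|M. P u \<tau> \<omega> \<omega>')" if "\<omega>' \<in> space N" for \<omega>'
        by (rule continuous_on_compose2[OF inner[OF that], of _ "\<lambda>u. (u, \<tau>)", simplified])
          (use s \<tau> in \<open>auto intro!: continuous_intros\<close>)
    qed (use s \<tau> EPm Pm1 Pb in \<open>auto intro!: M.abs_expectation_le\<close>)
    finally show ?thesis by (simp add: \<psi>_def)
  qed
  have \<phi>_swap: "\<phi> s \<tau> = (LINT \<omega>|M. LINT \<omega>'|N. H s \<tau> \<omega> \<omega>')" if "s \<in> {0..t}" "\<tau> \<in> {0..t}" for s \<tau>
    unfolding \<phi>_def by (rule fubini[OF Hm[OF that] Hb, symmetric])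
  have \<psi>_swap: "\<psi> s \<tau> = (LINT \<omega>|M. LINT \<omega>'|N. P s \<tau> \<omega> \<omega>')" if "s \<in> {0..t}" "\<tau> \<in> {0..t}" for s \<tau>
    unfolding \<psi>_def by (rule fubini[OF Pm[OF that] Pb, symmetric])
  have V0: "AE \<omega>' in N. V 0 \<omega>' = 1"
    using N.starts_at_zero by eventually_elim (simp add: V_def)
  have start': "(LINT \<omega>'|N. H s 0 \<omega> \<omega>') = exp (- lam * cosh (X s \<omega>))" for s \<omega>
  proof -
    have "(LINT \<omega>'|N. H s 0 \<omega> \<omega>') = (LINT \<omega>'|N. exp (- lam * cosh (X s \<omega>)))"
    proof (rule integral_cong_AE)
      show "AE \<omega>' in N. H s 0 \<omega> \<omega>' = exp (- lam * cosh (X s \<omega>))"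
        using V0 by eventually_elim (simp add: H_def D_def)
    qed (use Hm2[of 0] t in auto)
    then show ?thesis by (simp add: N.prob_space)
  qed
  have d2: "\<phi> s \<tau> - \<phi> s 0 = integral {0..\<tau>} (\<lambda>u. \<psi> s u)" if s: "s \<in> {0..t}" and \<tau>: "\<tau> \<in> {0..t}" for s \<tau>
  proof (cases "\<tau> = 0")
    case True
    then show ?thesis by simp
  next
    case False
    with \<tau> have \<tau>0: "\<tau> > 0" by simp
    have inner_eq: "(LINT \<omega>'|N. H s \<tau> \<omega> \<omega>') - (LINT \<omega>'|N. H s 0 \<omega> \<omega>') = integral {0..\<tau>} (\<lambda>u. LINT \<omega>'|N. P s u \<omega> \<omega>')" for \<omega>
      using N.expectation_exp_functional[OF \<tau>0 lam \<mu>, of "X s \<omega>"]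
      unfolding start' unfolding H_def P_def D_def V_def .
    have Hi: "integrable M (\<lambda>\<omega>. LINT \<omega>'|N. H s \<tau>' \<omega> \<omega>')" if "\<tau>' \<in> {0..t}" for \<tau>'
      by (rule M.integrable_const_bound[where B=1]) (use EHm'[OF s that] Hm2[OF that] Hb in \<open>auto intro!: N.abs_expectation_le\<close>)
    have "\<phi> s \<tau> - \<phi> s 0 = (LINT \<omega>|M. integral {0..\<tau>} (\<lambda>u. LINT \<omega>'|N. P s u \<omega> \<omega>'))"
      unfolding inner_eq[symmetric] using Hi[OF \<tau>] Hi[of 0] t s \<tau> by (simp add: \<phi>_swap)
    also have "\<dots> = integral {0..\<tau>} (\<lambda>u. LINT \<omega>|M. LINT \<omega>'|N. P s u \<omega> \<omega>')"
    proof (rule expectation_integral_swap[OF M.prob_space_axioms, where K=L])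
      show "continuous_on {0..\<tau>} (\<lambda>u. LINT \<omega>'|N. P s u \<omega> \<omega>')" for \<omega>
      proof (rule expectation_continuous_on[OF N.prob_space_axioms, where K=L])
        show "AE \<omega>' in N. continuous_on {0..\<tau>} (\<lambda>u. P s u \<omega> \<omega>')"
          unfolding P_def
          by (intro AE_I2 continuous_intros Vc continuous_on_subset[OF Dc]) (use \<tau> in auto)
      qed (use Pm2 Pb \<tau> in auto)
    qed (use s \<tau> EPm' Pm2 Pb in \<open>auto intro!: N.abs_expectation_le\<close>)
    also have "\<dots> = integral {0..\<tau>} (\<lambda>u. \<psi> s u)"
      by (rule integral_cong) (use s \<tau> \<psi>_swap in auto)
    finally show ?thesis .
  qed
  have exp_merge: "exp (- (lam * v) * c) * exp (- a) = exp (- lam * c * v - a)" for v c a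
    by (simp add: mult_exp_exp algebra_simps)
  have "\<phi> t 0 = \<phi> 0 t" by (rule equal_partials_antidiagonal[OF t \<psi>_cont d1 d2])
  moreover have "\<phi> t 0 = (LINT \<omega>|M. exp (- lam * cosh (X t \<omega>)))"
    using \<phi>_swap[of t 0] t by (simp add: start')
  moreover have "\<phi> 0 t = (LINT \<omega>|N. exp (- lam * cosh x * V t \<omega> - lam\<^sup>2 / 2 * integral {0..t} (\<lambda>u. (V u \<omega>)\<^sup>2)))"
    unfolding \<phi>_def start D_def exp_merge ..
  ultimately show ?thesis by simp
qed

theorem theorem2p3:
  fixes M :: "'a measure" and F :: "real \<Rightarrow> 'a measure" and B R :: "real \<Rightarrow> 'a \<Rightarrow> real"
    and N :: "'b measure" and G :: "real \<Rightarrow> 'b measure" and W V :: "real \<Rightarrow> 'b \<Rightarrow> real"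
    and \<alpha> x t lam :: real
  assumes "\<alpha> \<ge> -1/2" and "x \<ge> 0"
    and "hyperbolic_bessel_process M F B \<alpha> x R"
    and "brownian_motion N G W"
    and V: "\<And>u \<omega>. V u \<omega> = exp ((\<alpha> + 1/2) * u + W u \<omega>)"
    and "t > 0" and "lam > 0"
  shows "(LINT \<omega>|M. exp (- lam * cosh (R t \<omega>))) =
    (LINT \<omega>|N. exp (- lam * cosh x * V t \<omega> - lam\<^sup>2 / 2 * (LBINT u:{0..t}. (V u \<omega>)\<^sup>2)))"
proof -
  have bm: "brownian_motion M F B" and RF: "\<And>s. s \<ge> 0 \<Longrightarrow> R s \<in> borel_measurable (F s)"
    using assms(3) unfolding hyperbolic_bessel_process_def by auto
  interpret M: brownian_motion M F B by (rule bm)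
  interpret N: brownian_motion N G W by fact
  define \<mu> where "\<mu> = \<alpha> + 1 / 2"
  have \<mu>: "\<mu> \<ge> 0" using assms(1) by (simp add: \<mu>_def)
  have cosh_m [measurable]: "(cosh :: real \<Rightarrow> real) \<in> borel_measurable borel"
    by (auto intro!: borel_measurable_continuous_onI continuous_intros)
  \<comment> \<open>For \<open>\<alpha> = -1/2\<close> the process \<open>\<bar>x + B\<bar>\<close> contains a local time, which has no density; but \<open>cosh\<close> is
    even, so \<open>X = x + B\<close> serves instead. Otherwise \<open>X = R\<close>.\<close>
  have "\<exists>X. (\<forall>s\<in>{0..t}. X s \<in> borel_measurable (F s)) \<and>
    (AE \<omega> in M. X 0 \<omega> = x \<and> (\<exists>c Z. has_rate t (\<lambda>u. X u \<omega> - B u \<omega>) c \<and> negligible Z \<and>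
      (\<forall>u\<in>{0..t} - Z. c u * sinh (X u \<omega>) = \<mu> * cosh (X u \<omega>)))) \<and>
    (AE \<omega> in M. cosh (R t \<omega>) = cosh (X t \<omega>))"
  proof (cases "\<alpha> = -1/2")
    case True
    then have abs: "AE \<omega> in M. \<forall>t\<ge>0. R t \<omega> = \<bar>x + B t \<omega>\<bar>"
      using assms(3) unfolding hyperbolic_bessel_process_def by simp
    show ?thesis
    proof (intro exI[of _ "\<lambda>s \<omega>. x + B s \<omega>"] conjI ballI)
      show "(\<lambda>\<omega>. x + B s \<omega>) \<in> borel_measurable (F s)" if "s \<in> {0..t}" for s
        using M.adapted[of s] that by auto
      have rate: "has_rate t (\<lambda>u. x + B u \<omega> - B u \<omega>) (\<lambda>_. 0)" for \<omega>
        by (rule has_rateI[where a=x]) auto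
      show "AE \<omega> in M. x + B 0 \<omega> = x \<and> (\<exists>c Z. has_rate t (\<lambda>u. x + B u \<omega> - B u \<omega>) c \<and> negligible Z \<and>
          (\<forall>u\<in>{0..t} - Z. c u * sinh (x + B u \<omega>) = \<mu> * cosh (x + B u \<omega>)))"
        using M.starts_at_zero
      proof eventually_elim
        case (elim \<omega>)
        have "\<mu> = 0" using True by (simp add: \<mu>_def)
        then show ?case
          using elim rate[of \<omega>] by (intro conjI exI[of _ "\<lambda>_. 0"] exI[of _ "{}"]) auto
      qed
      show "AE \<omega> in M. cosh (R t \<omega>) = cosh (x + B t \<omega>)"
        using abs by eventually_elim (use \<open>t > 0\<close> in \<open>simp add: abs_if\<close>)
    qed
  next
    case False
    with assms(3) have sde: "hyperbolic_bessel_sde M B \<alpha> x R"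
      unfolding hyperbolic_bessel_process_def by simp
    show ?thesis
    proof (intro exI[of _ R] conjI ballI)
      show "R s \<in> borel_measurable (F s)" if "s \<in> {0..t}" for s using RF that by auto
      show "AE \<omega> in M. R 0 \<omega> = x \<and> (\<exists>c Z. has_rate t (\<lambda>u. R u \<omega> - B u \<omega>) c \<and> negligible Z \<and>
          (\<forall>u\<in>{0..t} - Z. c u * sinh (R u \<omega>) = \<mu> * cosh (R u \<omega>)))"
        using sde[unfolded hyperbolic_bessel_sde_def] M.starts_at_zero
      proof eventually_elim
        case (elim \<omega>)
        define h where "h u = (if R u \<omega> \<noteq> 0 then coth (R u \<omega>) else 0)" for u
        define Z where "Z = {s\<in>{0..}. R s \<omega> = 0}"
        have R0: "R s \<omega> \<ge> 0" if "s \<ge> 0" for s using elim that by blast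
        have int: "set_integrable lborel {0..s} h" and
          eq: "R s \<omega> = x + B s \<omega> + \<mu> * (LBINT u:{0..s}. h u)" if "s \<ge> 0" for s
          using elim that unfolding h_def \<mu>_def by blast+
        have hk: "h integrable_on {0..s}" "(LBINT u:{0..s}. h u) = integral {0..s} h" if "s \<ge> 0" for s
          using set_borel_integral_eq_integral[OF int[OF that]] by auto
        have "has_rate t (\<lambda>u. R u \<omega> - B u \<omega>) (\<lambda>u. \<mu> * h u)"
        proof (rule has_rateI[where a=x])
          show "(\<lambda>u. \<mu> * h u) integrable_on {0..t}"
            using hk(1)[of t] \<open>t > 0\<close> by (intro integrable_on_mult_right) auto
          show "0 \<le> \<mu> * h u" if "u \<in> {0..t}" for u
            using R0[of u] that \<mu> by (auto simp: h_def coth_def intro!: mult_nonneg_nonneg divide_nonneg_nonneg)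
          show "R s \<omega> - B s \<omega> = x + integral {0..s} (\<lambda>u. \<mu> * h u)" if "s \<in> {0..t}" for s
            using eq[of s] hk(2)[of s] that by simp
        qed
        moreover have "negligible Z"
          using elim unfolding Z_def negligible_iff_null_sets by (blast intro: null_sets_completionI)
        moreover have "\<mu> * h u * sinh (R u \<omega>) = \<mu> * cosh (R u \<omega>)" if "u \<in> {0..t} - Z" for u
          using that by (auto simp: Z_def h_def coth_def)
        moreover have "R 0 \<omega> = x" using eq[of 0] hk(2)[of 0] elim by simp
        ultimately show ?case by blast
      qed
    qed simp
  qed
  then obtain X where X: "\<And>s. s \<in> {0..t} \<Longrightarrow> X s \<in> borel_measurable (F s)"
    and paths: "AE \<omega> in M. X 0 \<omega> = x \<and> (\<exists>c Z. has_rate t (\<lambda>u. X u \<omega> - B u \<omega>) c \<and> negligible Z \<and>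
      (\<forall>u\<in>{0..t} - Z. c u * sinh (X u \<omega>) = \<mu> * cosh (X u \<omega>)))"
    and RX: "AE \<omega> in M. cosh (R t \<omega>) = cosh (X t \<omega>)"
    by blast
  have [measurable]: "R t \<in> borel_measurable M" "X t \<in> borel_measurable M"
    using M.adapted_measurable[OF RF[of t]] M.adapted_measurable[OF X[of t]] \<open>t > 0\<close> by auto
  have V_eq: "V = (\<lambda>u \<omega>. exp (\<mu> * u + W u \<omega>))"
    using V by (simp add: fun_eq_iff \<mu>_def)
  have "(LINT \<omega>|M. exp (- lam * cosh (R t \<omega>))) = (LINT \<omega>|M. exp (- lam * cosh (X t \<omega>)))"
    by (rule integral_cong_AE) (use RX in \<open>measurable, auto\<close>)
  also have "\<dots> = (LINT \<omega>|N. exp (- lam * cosh x * V t \<omega> - lam\<^sup>2 / 2 * integral {0..t} (\<lambda>u. (V u \<omega>)\<^sup>2)))"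
    unfolding V_eq by (rule expectation_duality[OF bm assms(4,6,7) \<mu> X paths])
  also have "\<dots> = (LINT \<omega>|N. exp (- lam * cosh x * V t \<omega> - lam\<^sup>2 / 2 * (LBINT u:{0..t}. (V u \<omega>)\<^sup>2)))"
  proof (rule Bochner_Integration.integral_cong[OF refl])
    fix \<omega> assume \<omega>: "\<omega> \<in> space N"
    have "continuous_on {0..t} (\<lambda>u. (V u \<omega>)\<^sup>2)"
      unfolding V_eq
      by (intro continuous_intros continuous_on_subset[OF N.continuous_paths[OF \<omega>]]) auto
    then have "set_integrable lborel {0..t} (\<lambda>u. (V u \<omega>)\<^sup>2)"
      by (rule borel_integrable_atLeastAtMost')
    then show "exp (- lam * cosh x * V t \<omega> - lam\<^sup>2 / 2 * integral {0..t} (\<lambda>u. (V u \<omega>)\<^sup>2)) =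
        exp (- lam * cosh x * V t \<omega> - lam\<^sup>2 / 2 * (LBINT u:{0..t}. (V u \<omega>)\<^sup>2))"
      by (simp add: set_borel_integral_eq_integral(2))
  qed
  finally show ?thesis .
qed

end
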